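(* Let $V$ be a simple unitary VOA of strong CFT type (over $\mathbb{C}$) with an anti-involution $\sigma$, with conformal vector $\omega$, and let $V^\sigma=\{v\in V\mid\sigma(v)=v\}$. Then $\mathrm{Aut}(V^\sigma)\cong\mathrm{Aut}^{-}V^\sigma\rtimes\mathrm{Aut}_\omega V^\sigma$. Furthermore, if $J_1(V)=0$, then $\mathrm{Aut}(V^\sigma)\cong\mathrm{Aut}_\omega V^\sigma$.
   Context: For a vertex algebra $V$ over $\mathbb{K}=\mathbb{R}$ or $\mathbb{C}$ with vacuum vector $\mathbf{1}$, $a(n)b$ denotes the $n$-th product ($n\in\mathbb{Z}$), $a(n)\in\mathrm{End}\,V$, $Y(a,z)=\sum_n a(n)z^{-n-1}$, and $Ta=a(-2)\mathbf{1}$. A $\mathbb{Z}$-graded vertex algebra is a vertex algebra $V=\bigoplus_{n\in\mathbb{Z}}V_n$ with $V_n(k)V_m\subset V_{n+m-k-1}$ and $\mathbf{1}\in V_0$. A $\mathbb{Z}$-graded conformal vertex algebra $(V,\omega)$ is a $\mathbb{Z}$-graded vertex algebra with a distinguished $\omega\in V_2$ such that the operators $L(n)=\omega(n+1)$ satisfy $[L(n),L(m)]=(n-m)L(n+m)+\frac{1}{12}\delta_{n+m,0}(n^3-n)c$ for some $c\in\mathbb{K}$, $L(0)v=nv$ for $v\in V_n$, and $L(-1)=T$. It is a VOA of CFT type if $V=\bigoplus_{n\in\mathbb{N}}V_n$ (with $\mathbb{N}=\{0,1,2,\dots\}$), $\dim V_n<\infty$ for all $n$, and $V_0=\mathbb{K}\mathbf{1}$.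 It is a VOA of strong CFT type if moreover $L(1)V_1=0$. Simple means that $V$ has no nontrivial proper ideals. A unitary VOA is a VOA $(V,\omega)$ over $\mathbb{C}$ with an anti-involution $\sigma$ (an antilinear bijection with $\sigma^2=\mathrm{id}$, $\sigma(\mathbf{1})=\mathbf{1}$, $\sigma(\omega)=\omega$, $\sigma(a(n)b)=\sigma(a)(n)\sigma(b)$) and a positive-definite Hermitian form $(\,,\,)$ which is invariant: $(Y(e^{zL(1)}(-z^{-2})^{L(0)}a,z^{-1})u,v)=(u,Y(\sigma(a),z)v)$ for all $a,u,v\in V$. The fixed-point set $V^\sigma$, with the same $\omega$, is a VOA over $\mathbb{R}$, graded by $V^\sigma_n=V^\sigma\cap V_n$. For a VOA $W=\bigoplus_{n\in\mathbb{N}}W_n$ of CFT type with conformal vector $\omega$: $\mathrm{Aut}\,W$ is the group of vertex algebra automorphisms (linear isomorphisms over the base field preserving all products and $\mathbf{1}$); $\mathrm{Aut}_\omega W=\{f\in\mathrm{Aut}\,W\mid f(\omega)=\omega\}$; with $\mathrm{pr}_n:W\to W_n$ the canonical projection, $\mathrm{Aut}^{-}W=\{f\in\mathrm{Aut}\,W\mid f(W_n)\subset\bigoplus_{k\le n}W_k\text{ and }\mathrm{pr}_n\circ f|_{W_n}=\mathrm{id}_{W_n}\text{ for all }n\}$; $J_1(W)=\{a\in W_1\mid a(0)=0\}$. *)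

theory Defs
  imports Complex_Main "HOL-Library.Groups_Big_Fun" "HOL-Algebra.Bij" "HOL-Algebra.Coset"
begin

section \<open>Vertex algebras\<close>

text \<open>
  Addition comes from the ambient type, while the underlying vector space of the vertex algebra
  is the subspace \<open>carrier V\<close> of that type.  This allows the real form
  \<open>V\<^sup>\<sigma>\<close> of a complex vertex algebra to live in the same type as \<open>V\<close>.
  The term \<open>nprod V a n b\<close> is the product \<open>a(n)b\<close>.
\<close>

record ('k, 'v) vertex_algebra = "'v partial_object" +
  scl :: "'k \<Rightarrow> 'v \<Rightarrow> 'v"
  nprod :: "'v \<Rightarrow> int \<Rightarrow> 'v \<Rightarrow> 'v"
  vac :: 'v

record ('k, 'v) conformal_va = "('k, 'v) vertex_algebra" +
  grade :: "int \<Rightarrow> 'v set"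
  conf :: 'v

text \<open>
  In the Borcherds identity below all sums have finite support by truncation,
  so \<open>Sum_any\<close> is the genuine sum.
\<close>

locale vertex_algebra = vector_space "scl V"
  for V :: "('k::field_char_0, 'v::ab_group_add, 'm) vertex_algebra_scheme" +
  assumes carrier_subspace: "subspace (carrier V)"
    and vac_closed: "vac V \<in> carrier V"
    and nprod_closed: "\<lbrakk>a \<in> carrier V; b \<in> carrier V\<rbrakk> \<Longrightarrow> nprod V a n b \<in> carrier V"
    and nprod_add_left: "\<lbrakk>a \<in> carrier V; a' \<in> carrier V; b \<in> carrier V\<rbrakk>
      \<Longrightarrow> nprod V (a + a') n b = nprod V a n b + nprod V a' n b"
    and nprod_add_right: "\<lbrakk>a \<in> carrier V; b \<in> carrier V; b' \<in> carrier V\<rbrakk>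
      \<Longrightarrow> nprod V a n (b + b') = nprod V a n b + nprod V a n b'"
    and nprod_scl_left: "\<lbrakk>a \<in> carrier V; b \<in> carrier V\<rbrakk>
      \<Longrightarrow> nprod V (scl V k a) n b = scl V k (nprod V a n b)"
    and nprod_scl_right: "\<lbrakk>a \<in> carrier V; b \<in> carrier V\<rbrakk>
      \<Longrightarrow> nprod V a n (scl V k b) = scl V k (nprod V a n b)"
    and truncation: "\<lbrakk>a \<in> carrier V; b \<in> carrier V\<rbrakk> \<Longrightarrow> \<exists>N. \<forall>n\<ge>N. nprod V a n b = 0"
    and creation: "\<lbrakk>a \<in> carrier V; n \<ge> 0\<rbrakk> \<Longrightarrow> nprod V a n (vac V) = 0"
    and vac_right: "a \<in> carrier V \<Longrightarrow> nprod V a (-1) (vac V) = a"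
    and borcherds: "\<lbrakk>a \<in> carrier V; b \<in> carrier V; c \<in> carrier V\<rbrakk> \<Longrightarrow>
      Sum_any (\<lambda>i::nat. scl V (of_int p gchoose i)
        (nprod V (nprod V a (r + int i) b) (p + q - int i) c)) =
      Sum_any (\<lambda>i::nat. scl V ((-1) ^ i * (of_int r gchoose i))
        (nprod V a (p + r - int i) (nprod V b (q + int i) c)
         - scl V ((-1) powi r) (nprod V b (q + r - int i) (nprod V a (p + int i) c))))"

definition va_ideal :: "('k::field_char_0, 'v::ab_group_add, 'm) vertex_algebra_scheme \<Rightarrow> 'v set \<Rightarrow> bool"
  where "va_ideal V I \<longleftrightarrow> module.subspace (scl V) I \<and> I \<subseteq> carrier V \<and>
    (\<forall>a\<in>carrier V. \<forall>v\<in>I. \<forall>n. nprod V a n v \<in> I \<and> nprod V v n a \<in> I)"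

definition simple_va :: "('k::field_char_0, 'v::ab_group_add, 'm) vertex_algebra_scheme \<Rightarrow> bool"
  where "simple_va V \<longleftrightarrow> (\<forall>I. va_ideal V I \<longrightarrow> I = {0} \<or> I = carrier V)"

section \<open>Gradings and conformal vectors\<close>

definition homogeneous_decomp ::
    "('k::field_char_0, 'v::ab_group_add, 'm) conformal_va_scheme \<Rightarrow> 'v \<Rightarrow> (int \<Rightarrow> 'v) \<Rightarrow> bool"
  where "homogeneous_decomp V v x \<longleftrightarrow>
    (\<forall>n. x n \<in> grade V n) \<and> finite {n. x n \<noteq> 0} \<and> v = Sum_any x"

text \<open>The projection \<open>pr\<^sub>n : V \<rightarrow> V\<^sub>n\<close>; well-defined when \<open>V\<close> is the direct sum of its graded pieces.\<close>

definition pr :: "('k::field_char_0, 'v::ab_group_add, 'm) conformal_va_scheme \<Rightarrow> int \<Rightarrow> 'v \<Rightarrow> 'v"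
  where "pr V n v = (THE x. homogeneous_decomp V v x) n"

locale graded_vertex_algebra = vertex_algebra V
  for V :: "('k::field_char_0, 'v::ab_group_add, 'm) conformal_va_scheme" +
  assumes grade_subspace: "subspace (grade V n)"
    and grade_subset: "grade V n \<subseteq> carrier V"
    and direct_sum: "v \<in> carrier V \<Longrightarrow> \<exists>!x. homogeneous_decomp V v x"
    and grade_nprod: "\<lbrakk>a \<in> grade V n; b \<in> grade V m\<rbrakk> \<Longrightarrow> nprod V a k b \<in> grade V (n + m - k - 1)"
    and vac_grade: "vac V \<in> grade V 0"

definition Vir :: "('k::field_char_0, 'v::ab_group_add, 'm) conformal_va_scheme \<Rightarrow> int \<Rightarrow> 'v \<Rightarrow> 'v"
  where "Vir V n = nprod V (conf V) (n + 1)"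

locale conformal_vertex_algebra = graded_vertex_algebra V
  for V :: "('k::field_char_0, 'v::ab_group_add, 'm) conformal_va_scheme" +
  assumes conf_grade: "conf V \<in> grade V 2"
    and virasoro: "\<exists>c. \<forall>n m. \<forall>v\<in>carrier V.
      Vir V n (Vir V m v) - Vir V m (Vir V n v) =
      scl V (of_int (n - m)) (Vir V (n + m) v)
      + scl V (if n + m = 0 then of_int (n ^ 3 - n) / 12 * c else 0) v"
    and L0_grade: "v \<in> grade V n \<Longrightarrow> Vir V 0 v = scl V (of_int n) v"
    and translation: "v \<in> carrier V \<Longrightarrow> Vir V (-1) v = nprod V v (-2) (vac V)"

locale CFT_type = conformal_vertex_algebra V
  for V :: "('k::field_char_0, 'v::ab_group_add, 'm) conformal_va_scheme" +
  assumes grade_neg: "n < 0 \<Longrightarrow> grade V n = {0}"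
    and grade_finite_dim: "\<exists>B. finite B \<and> grade V n = span B"
    and grade_zero: "grade V 0 = range (\<lambda>k. scl V k (vac V))"

locale strong_CFT_type = CFT_type V
  for V :: "('k::field_char_0, 'v::ab_group_add, 'm) conformal_va_scheme" +
  assumes L1_grade_one: "v \<in> grade V 1 \<Longrightarrow> Vir V 1 v = 0"

definition J1 :: "('k::field_char_0, 'v::ab_group_add, 'm) conformal_va_scheme \<Rightarrow> 'v set"
  where "J1 V = {a \<in> grade V 1. \<forall>v\<in>carrier V. nprod V a 0 v = 0}"

section \<open>Unitary structures and real forms\<close>

text \<open>
  The coefficient of \<open>z\<^bsup>-p-1\<^esup>\<close> in \<open>Y(e\<^bsup>zL(1)\<^esup>(-z\<^bsup>-2\<^esup>)\<^bsup>L(0)\<^esup>a, z\<^bsup>-1\<^esup>)u\<close>.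
  A homogeneous component \<open>a\<^sub>n\<close> of degree \<open>n\<close> contributes
  \<open>\<Sum>\<^sub>k (-1)\<^sup>n / k! z\<^bsup>k-2n\<^esup> Y(L(1)\<^sup>k a\<^sub>n, z\<^bsup>-1\<^esup>)u\<close>, and \<open>Y(b, z\<^bsup>-1\<^esup>)u\<close> is the sum of the
  \<open>b(m)u z\<^bsup>m+1\<^esup>\<close>, so the relevant mode is \<open>m = 2n - k - p - 2\<close>.
  The sum over \<open>k\<close> is finite when the grading is bounded below.
\<close>

definition opposite_mode ::
    "('k::field_char_0, 'v::ab_group_add, 'm) conformal_va_scheme \<Rightarrow> 'v \<Rightarrow> int \<Rightarrow> 'v \<Rightarrow> 'v"
  where "opposite_mode V a p u =
    Sum_any (\<lambda>n::int. Sum_any (\<lambda>k::nat. scl V ((-1) powi n / fact k)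
      (nprod V ((Vir V 1 ^^ k) (pr V n a)) (2 * n - int k - p - 2) u)))"

locale unitary_structure =
  fixes V :: "(complex, 'v::ab_group_add, 'm) conformal_va_scheme"
    and \<sigma> :: "'v \<Rightarrow> 'v"
    and form :: "'v \<Rightarrow> 'v \<Rightarrow> complex"
  assumes \<sigma>_bij: "bij_betw \<sigma> (carrier V) (carrier V)"
    and \<sigma>_add: "\<lbrakk>u \<in> carrier V; v \<in> carrier V\<rbrakk> \<Longrightarrow> \<sigma> (u + v) = \<sigma> u + \<sigma> v"
    and \<sigma>_antilinear: "v \<in> carrier V \<Longrightarrow> \<sigma> (scl V c v) = scl V (cnj c) (\<sigma> v)"
    and \<sigma>_involution: "v \<in> carrier V \<Longrightarrow> \<sigma> (\<sigma> v) = v"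
    and \<sigma>_vac: "\<sigma> (vac V) = vac V"
    and \<sigma>_conf: "\<sigma> (conf V) = conf V"
    and \<sigma>_nprod: "\<lbrakk>a \<in> carrier V; b \<in> carrier V\<rbrakk> \<Longrightarrow> \<sigma> (nprod V a n b) = nprod V (\<sigma> a) n (\<sigma> b)"
    and form_add: "\<lbrakk>u \<in> carrier V; u' \<in> carrier V; v \<in> carrier V\<rbrakk>
      \<Longrightarrow> form (u + u') v = form u v + form u' v"
    and form_scl: "\<lbrakk>u \<in> carrier V; v \<in> carrier V\<rbrakk> \<Longrightarrow> form (scl V c u) v = c * form u v"
    and form_hermitian: "\<lbrakk>u \<in> carrier V; v \<in> carrier V\<rbrakk> \<Longrightarrow> form v u = cnj (form u v)"
    and form_pos: "\<lbrakk>v \<in> carrier V; v \<noteq> 0\<rbrakk> \<Longrightarrow> Re (form v v) > 0"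
    and form_invariant: "\<lbrakk>a \<in> carrier V; u \<in> carrier V; v \<in> carrier V\<rbrakk>
      \<Longrightarrow> form (opposite_mode V a p u) v = form u (nprod V (\<sigma> a) p v)"

definition real_form ::
    "(complex, 'v::ab_group_add, 'm) conformal_va_scheme \<Rightarrow> ('v \<Rightarrow> 'v) \<Rightarrow> (real, 'v) conformal_va"
  where "real_form V \<sigma> =
    \<lparr>carrier = {v \<in> carrier V. \<sigma> v = v}, scl = (\<lambda>r. scl V (complex_of_real r)),
     nprod = nprod V, vac = vac V,
     grade = (\<lambda>n. {v \<in> grade V n. \<sigma> v = v}), conf = conf V\<rparr>"

section \<open>Automorphism groups\<close>

text \<open>As for \<^const>\<open>Bij\<close>, automorphisms are taken to be extensional functions on the carrier.\<close>

definition va_auts :: "('k::field_char_0, 'v::ab_group_add, 'm) vertex_algebra_scheme \<Rightarrow> ('v \<Rightarrow> 'v) set"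
  where "va_auts W = {f \<in> Bij (carrier W).
    (\<forall>u\<in>carrier W. \<forall>v\<in>carrier W. f (u + v) = f u + f v) \<and>
    (\<forall>k. \<forall>v\<in>carrier W. f (scl W k v) = scl W k (f v)) \<and>
    (\<forall>a\<in>carrier W. \<forall>b\<in>carrier W. \<forall>n. f (nprod W a n b) = nprod W (f a) n (f b)) \<and>
    f (vac W) = vac W}"

definition Aut :: "('k::field_char_0, 'v::ab_group_add, 'm) vertex_algebra_scheme \<Rightarrow> ('v \<Rightarrow> 'v) monoid"
  where "Aut W = BijGroup (carrier W) \<lparr>carrier := va_auts W\<rparr>"

definition conf_auts :: "('k::field_char_0, 'v::ab_group_add, 'm) conformal_va_scheme \<Rightarrow> ('v \<Rightarrow> 'v) set"
  where "conf_auts W = {f \<in> va_auts W. f (conf W) = conf W}"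

definition minus_auts :: "('k::field_char_0, 'v::ab_group_add, 'm) conformal_va_scheme \<Rightarrow> ('v \<Rightarrow> 'v) set"
  where "minus_auts W = {f \<in> va_auts W. \<forall>n.
    f ` grade W n \<subseteq> module.span (scl W) (\<Union>k\<in>{..n}. grade W k) \<and>
    (\<forall>v\<in>grade W n. pr W n (f v) = v)}"

definition Aut_conf :: "('k::field_char_0, 'v::ab_group_add, 'm) conformal_va_scheme \<Rightarrow> ('v \<Rightarrow> 'v) monoid"
  where "Aut_conf W = Aut W \<lparr>carrier := conf_auts W\<rparr>"

definition Aut_minus :: "('k::field_char_0, 'v::ab_group_add, 'm) conformal_va_scheme \<Rightarrow> ('v \<Rightarrow> 'v) monoid"
  where "Aut_minus W = Aut W \<lparr>carrier := minus_auts W\<rparr>"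

definition semidirect_product ::
    "('a, 'm) monoid_scheme \<Rightarrow> ('b, 'n) monoid_scheme \<Rightarrow> ('b \<Rightarrow> 'a \<Rightarrow> 'a) \<Rightarrow> ('a \<times> 'b) monoid"
  where "semidirect_product N H \<phi> =
    \<lparr>carrier = carrier N \<times> carrier H,
     mult = (\<lambda>(n, h) (n', h'). (n \<otimes>\<^bsub>N\<^esub> \<phi> h n', h \<otimes>\<^bsub>H\<^esub> h')),
     one = (\<one>\<^bsub>N\<^esub>, \<one>\<^bsub>H\<^esub>)\<rparr>"

definition conjugation :: "('a, 'm) monoid_scheme \<Rightarrow> 'a \<Rightarrow> 'a \<Rightarrow> 'a"
  where "conjugation G h n = h \<otimes>\<^bsub>G\<^esub> n \<otimes>\<^bsub>G\<^esub> inv\<^bsub>G\<^esub> h"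

end

theory Submission
  imports Defs
begin

text \<open>
  The real form \<open>W = V\<^sup>\<sigma>\<close> is a real vertex operator algebra, and the real part of the Hermitian form
  restricts to a positive-definite form on \<open>W\<close> for which a quasi-primary vector \<open>a\<close> of degree \<open>n\<close>
  satisfies \<open>a(p)\<^sup>* = (-1)\<^sup>n a(2n-2-p)\<close>.  Write \<open>W\<^sub>\<le>\<^sub>n\<close> for the sum of the components of degree at
  most \<open>n\<close>.  The heart of the matter is that every automorphism \<open>f\<close> of the vertex algebra \<open>W\<close>
  preserves this filtration, and that the induced automorphism \<open>gr f\<close> of the associated graded
  space, which is again \<open>W\<close>, fixes \<open>\<omega>\<close>.  Then \<open>gr\<close> is a homomorphism from \<open>Aut W\<close> to its subgroup
  \<open>Aut\<^sub>\<omega> W\<close>, it is the identity on that subgroup, and its kernel is \<open>Aut\<^sup>- W\<close> by definition; hence the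
  semidirect product.

  To control \<open>f\<close>, put \<open>a = f(\<omega>) - \<omega>\<close>.  Since \<open>f\<close> commutes with \<open>T\<close>, both conformal vectors have zero
  mode \<open>T\<close>, so \<open>a(0) = 0\<close>, and the same holds for each component \<open>a\<^sub>n\<close>.  Skew-symmetry applied to
  \<open>a\<^sub>n(0)\<omega> = 0\<close> yields \<open>Ta\<^sub>n = -T\<^sup>2y\<close> with \<open>y\<close> of degree \<open>n-1\<close> whenever \<open>n \<noteq> 1\<close>
  (\<open>central_zero_mode\<close>), whence \<open>a\<^sub>n(1) = y(0)\<close>.  For \<open>n \<ge> 2\<close> one may replace \<open>y\<close> by a quasi-primary
  vector \<open>q\<close> with the same zero mode (\<open>quasi_primary_zero_mode\<close>).  The operator
  \<open>f(\<omega>)(1) = L(0) + \<Sum>\<^sub>n a\<^sub>n(1)\<close> is conjugate to \<open>L(0)\<close>, hence diagonalizable, and \<open>a\<^sub>n(1)\<close> raises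
  degrees by \<open>n-2\<close>.  Let \<open>N \<ge> 2\<close> be maximal with \<open>a\<^sub>N(1) \<noteq> 0\<close>.
  If \<open>N > 2\<close>, then \<open>q(0)\<close> is locally nilpotent; conjugation with \<open>e\<^bsup>L(1)\<^esup>\<close> turns it into
  \<open>\<Sum>\<^sub>j binom(2d-2, j) q(j)\<close>, where \<open>d = N-1\<close> is the degree of \<open>q\<close>.  This operator is locally nilpotent
  on the image of \<open>e\<^bsup>L(1)\<^esup>\<close> and symmetric or skew-symmetric, so it vanishes there and \<open>q(0) = 0\<close>
  (\<open>nilpotent_zero_mode\<close>).  If \<open>N = 2\<close>, then \<open>q(0)\<close> is skew-symmetric and the diagonal part of a
  diagonalizable operator over the reals, and again \<open>q(0) = 0\<close> (\<open>diagonalizable_skew_zero_mode\<close>).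
  Therefore \<open>f(\<omega>)(1) = L(0) + a\<^sub>1(1)\<close>, where \<open>a\<^sub>1(1)\<close> lowers degrees, and comparison of eigenvectors
  shows that \<open>f\<close> preserves the filtration.

  Finally \<open>gr f(\<omega>) = \<omega> + a\<^sub>2\<close>, and \<open>L(1)W\<^sub>1 = 0\<close> forces \<open>a\<^sub>2(2) = 2y(1)\<close> to vanish on \<open>W\<^sub>1\<close>.
  Positivity gives \<open>y = 0\<close>, then \<open>Ta\<^sub>2 = 0\<close> and \<open>a\<^sub>2 = 0\<close> (\<open>gr_conf\<close>).  If \<open>J\<^sub>1 = 0\<close>, then
  \<open>a\<^sub>1 = 0\<close>, so that \<open>f\<close> commutes with \<open>L(0)\<close> and \<open>f = gr f\<close>.
\<close>

section \<open>Consequences of the Borcherds identity\<close>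

context vertex_algebra
begin

lemma zero_closed: "0 \<in> carrier V"
  using carrier_subspace subspace_0 by blast

lemma add_closed: "u \<in> carrier V \<Longrightarrow> v \<in> carrier V \<Longrightarrow> u + v \<in> carrier V"
  using carrier_subspace subspace_add by blast

lemma diff_closed: "u \<in> carrier V \<Longrightarrow> v \<in> carrier V \<Longrightarrow> u - v \<in> carrier V"
  using carrier_subspace subspace_diff by blast

lemma scl_closed: "v \<in> carrier V \<Longrightarrow> scl V k v \<in> carrier V"
  using carrier_subspace subspace_scale by blast

lemma sum_closed: "(\<And>i. i \<in> S \<Longrightarrow> x i \<in> carrier V) \<Longrightarrow> sum x S \<in> carrier V"
  using carrier_subspace subspace_sum by blast

lemmas closed = zero_closed add_closed diff_closed scl_closed sum_closed vac_closed nprod_closed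

lemma nprod_zero_left: "b \<in> carrier V \<Longrightarrow> nprod V 0 n b = 0"
  using nprod_add_left[of 0 0 b n] zero_closed by simp

lemma nprod_zero_right: "a \<in> carrier V \<Longrightarrow> nprod V a n 0 = 0"
  using nprod_add_right[of a 0 0 n] zero_closed by simp

lemma nprod_diff_left:
  assumes "a \<in> carrier V" "a' \<in> carrier V" "b \<in> carrier V"
  shows "nprod V (a - a') n b = nprod V a n b - nprod V a' n b"
  using nprod_add_left[of "a - a'" a' b n] assms diff_closed by simp

lemma nprod_diff_right:
  assumes "a \<in> carrier V" "b \<in> carrier V" "b' \<in> carrier V"
  shows "nprod V a n (b - b') = nprod V a n b - nprod V a n b'"
  using nprod_add_right[of a "b - b'" b' n] assms diff_closed by simp

lemma nprod_sum_left:
  assumes "b \<in> carrier V" "\<And>i. i \<in> S \<Longrightarrow> x i \<in> carrier V"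
  shows "nprod V (sum x S) n b = (\<Sum>i\<in>S. nprod V (x i) n b)"
  using assms(2)
  by (induction S rule: infinite_finite_induct)
    (auto simp: nprod_zero_left assms(1) nprod_add_left sum_closed)

lemma nprod_sum_right:
  assumes "a \<in> carrier V" "\<And>i. i \<in> S \<Longrightarrow> x i \<in> carrier V"
  shows "nprod V a n (sum x S) = (\<Sum>i\<in>S. nprod V a n (x i))"
  using assms(2)
  by (induction S rule: infinite_finite_induct)
    (auto simp: nprod_zero_right assms(1) nprod_add_right sum_closed)

lemma commutator:
  assumes "a \<in> carrier V" "b \<in> carrier V" "c \<in> carrier V"
  shows "nprod V a p (nprod V b q c) - nprod V b q (nprod V a p c) =
    Sum_any (\<lambda>i::nat. scl V (of_int p gchoose i)
      (nprod V (nprod V a (int i) b) (p + q - int i) c))"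
proof -
  have "Sum_any (\<lambda>i::nat. scl V ((-1) ^ i * (of_int 0 gchoose i))
        (nprod V a (p + 0 - int i) (nprod V b (q + int i) c)
         - scl V ((-1) powi 0) (nprod V b (q + 0 - int i) (nprod V a (p + int i) c))))
     = nprod V a p (nprod V b q c) - nprod V b q (nprod V a p c)"
    by (subst Sum_any.expand_superset[of "{0}"]) (auto simp: gbinomial_0_left)
  with borcherds[OF assms, of p 0 q] show ?thesis by simp
qed

text \<open>The Borcherds identity with \<open>p = -1\<close>, \<open>q = 0\<close> and \<open>c = \<one>\<close>.  The vectors \<open>x(-1-i)\<one>\<close> are the divided
  powers \<open>T\<^sup>i x / i!\<close>, so this is the usual skew-symmetry.\<close>

lemma skew_symmetry:
  assumes a: "a \<in> carrier V" and b: "b \<in> carrier V"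
    and M: "\<And>n. n \<ge> r + int M \<Longrightarrow> nprod V a n b = 0"
  shows "nprod V b r a = (\<Sum>i<M. scl V ((-1) powi (r + int i + 1))
    (nprod V (nprod V a (r + int i) b) (-1 - int i) (vac V)))"
proof -
  define t where "t i = nprod V (nprod V a (r + int i) b) (-1 - int i) (vac V)" for i
  have choose: "((of_int (-1) :: 'k) gchoose i) = (-1) ^ i" for i
    using gbinomial_minus[of "1::'k" i] binomial_gbinomial[of i i, where ?'a = 'k] by simp
  have "Sum_any (\<lambda>i::nat. scl V (of_int (-1) gchoose i)
        (nprod V (nprod V a (r + int i) b) (-1 + 0 - int i) (vac V))) =
      Sum_any (\<lambda>i::nat. scl V ((-1) ^ i * (of_int r gchoose i))
        (nprod V a (-1 + r - int i) (nprod V b (0 + int i) (vac V))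
         - scl V ((-1) powi r) (nprod V b (0 + r - int i) (nprod V a (-1 + int i) (vac V)))))"
    by (rule borcherds[OF a b vac_closed])
  also have "\<dots> = - scl V ((-1) powi r) (nprod V b r a)"
  proof -
    have "i = 0" if "nprod V b m (nprod V a (int i - 1) (vac V)) \<noteq> 0" for i m
      using that by (cases "i = 0") (simp_all add: creation a b nprod_zero_right)
    then show ?thesis
      by (subst Sum_any.expand_superset[of "{0}"])
        (auto simp: creation vac_right nprod_zero_right a b)
  qed
  also have "Sum_any (\<lambda>i::nat. scl V (of_int (-1) gchoose i)
        (nprod V (nprod V a (r + int i) b) (-1 + 0 - int i) (vac V)))
      = (\<Sum>i<M. scl V ((-1) ^ i) (t i))"
    unfolding choose
  proof (subst Sum_any.expand_superset[of "{..<M}"])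
    have "nprod V (nprod V a (r + int i) b) m (vac V) = 0" if "i \<ge> M" for i m
      using M[of "r + int i"] that by (simp add: nprod_zero_left vac_closed)
    then show "{i. scl V ((-1) ^ i) (nprod V (nprod V a (r + int i) b) (-1 + 0 - int i) (vac V)) \<noteq> 0} \<subseteq> {..<M}"
      by (auto simp: not_less[symmetric])
  qed (simp_all add: t_def)
  finally have "scl V (- ((-1) powi r)) (\<Sum>i<M. scl V ((-1) ^ i) (t i))
      = scl V ((-1) powi r * (-1) powi r) (nprod V b r a)"
    by simp
  also have "((-1) powi r * (-1) powi r :: 'k) = 1"
    by (simp flip: power_int_mult_distrib)
  finally show ?thesis
    by (simp add: scale_sum_right power_int_add t_def)
qed

lemma vac_nprod_nonneg:
  assumes "a \<in> carrier V" "n \<ge> 0"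
  shows "nprod V (vac V) n a = 0"
  using skew_symmetry[OF assms(1) vac_closed, of n 0] assms by (simp add: creation)

lemma vac_nprod_minus_one:
  assumes "a \<in> carrier V"
  shows "nprod V (vac V) (-1) a = a"
  using skew_symmetry[OF assms vac_closed, of "-1" 1] assms by (simp add: creation vac_right)

text \<open>In the Borcherds identity with \<open>a = b = c = \<one>\<close>, \<open>p = 0\<close>, \<open>q = -m\<close>, \<open>r = -1\<close> only the two extreme terms
  survive by induction, and each of them equals the left-hand side \<open>\<one>(-m)\<one>\<close>.\<close>

lemma vac_nprod_vac:
  assumes "m \<ge> 2"
  shows "nprod V (vac V) (- int m) (vac V) = 0"
  using assms
proof (induction m rule: less_induct)
  case (less m)
  have choose: "(-1) ^ i * ((of_int (-1) :: 'k) gchoose i) = 1" for i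
    using gbinomial_minus[of "1::'k" i] binomial_gbinomial[of i i, where ?'a = 'k]
    by (simp flip: power_mult_distrib mult.assoc)
  let ?t = "\<lambda>i. nprod V (vac V) (-1 - int i) (nprod V (vac V) (- int m + int i) (vac V))"
  have t0: "?t i = 0" if "i \<notin> {0, m - 1}" for i
  proof (cases "i < m")
    case True
    then have "nprod V (vac V) (- int (m - i)) (vac V) = 0"
      using that less.prems by (intro less.IH) auto
    moreover have "- int (m - i) = - int m + int i" using True by simp
    ultimately show ?thesis by (simp add: nprod_zero_right vac_closed)
  next
    case False
    then show ?thesis by (simp add: creation nprod_zero_right vac_closed)
  qed
  have "nprod V (vac V) (- int m) (vac V) = Sum_any ?t"
    using borcherds[OF vac_closed vac_closed vac_closed, of 0 "-1" "- int m"]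
    by (subst (asm) Sum_any.expand_superset[of "{0}"])
      (auto simp: gbinomial_0_left choose[simplified] vac_right creation nprod_zero_right vac_closed)
  also have "\<dots> = (\<Sum>i\<in>{0, m - 1}. ?t i)"
    using t0 by (intro Sum_any.expand_superset) auto
  also have "\<dots> = nprod V (vac V) (- int m) (vac V) + nprod V (vac V) (- int m) (vac V)"
    using less.prems by (simp add: vac_nprod_minus_one vac_right nprod_closed vac_closed)
  finally show ?case by simp
qed

lemma vac_nprod:
  assumes a: "a \<in> carrier V"
  shows "nprod V (vac V) n a = (if n = -1 then a else 0)"
proof -
  consider "n \<ge> 0" | "n = -1" | m where "n = - int m" "m \<ge> 2"
    by (cases "n \<ge> 0"; cases "n = -1") (auto intro: that(3)[of "nat (-n)"])
  then show ?thesis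
  proof cases
    case 3
    have "nprod V (vac V) n (nprod V a (-1) (vac V)) = nprod V a (-1) (nprod V (vac V) n (vac V))"
      using commutator[OF vac_closed a vac_closed, of n "-1"]
      by (simp add: vac_nprod_nonneg a nprod_zero_left vac_closed)
    then show ?thesis using 3 by (simp add: vac_right a vac_nprod_vac nprod_zero_right)
  qed (simp_all add: vac_nprod_nonneg vac_nprod_minus_one a)
qed

text \<open>This is the rule \<open>Y(Ta, z) = d/dz Y(a, z)\<close> in terms of modes.\<close>

lemma nprod_translation:
  assumes a: "a \<in> carrier V" and c: "c \<in> carrier V"
  shows "nprod V (nprod V a (-2) (vac V)) n c = scl V (- of_int n) (nprod V a (n - 1) c)"
proof -
  have choose: "(-1) ^ i * ((of_int (-2) :: 'k) gchoose i) = 1 + of_nat i" for i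
    using gbinomial_minus[of "2::'k" i] binomial_gbinomial[of "Suc i" i, where ?'a = 'k]
    by (simp flip: power_mult_distrib mult.assoc add: add.commute)
  let ?t = "\<lambda>i. scl V (1 + of_nat i) (nprod V a (-2 - int i) (nprod V (vac V) (n + int i) c)
      - nprod V (vac V) (n - 2 - int i) (nprod V a (int i) c))"
  have t0: "?t i = 0" if "i \<notin> {nat (-1 - n), nat (n - 1)}" for i
  proof -
    have "n + int i \<noteq> -1" "n - 2 - int i \<noteq> -1" using that by auto
    then show ?thesis by (simp add: vac_nprod a c nprod_closed nprod_zero_right)
  qed
  have "nprod V (nprod V a (-2) (vac V)) n c = Sum_any ?t"
    using borcherds[OF a vac_closed c, of 0 "-2" n]
    by (subst (asm) Sum_any.expand_superset[of "{0}"])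
      (auto simp: gbinomial_0_left choose[simplified])
  also have "\<dots> = sum ?t {nat (-1 - n), nat (n - 1)}"
    using t0 by (intro Sum_any.expand_superset) auto
  also have "\<dots> = scl V (- of_int n) (nprod V a (n - 1) c)"
  proof -
    consider "n < 0" | "n = 0" | "n > 0" by linarith
    then show ?thesis
    proof cases
      case 1
      define m where "m = nat (-1 - n)"
      have m: "nat (n - 1) = 0" "n = -1 - int m" using 1 by (auto simp: m_def)
      have "sum ?t {m, 0} = ?t m"
      proof (cases "m = 0")
        case False
        then show ?thesis using m by (simp add: vac_nprod a c nprod_closed nprod_zero_right)
      qed simp
      also have "\<dots> = scl V (- of_int n) (nprod V a (n - 1) c)"
        using m by (simp add: vac_nprod a c nprod_closed)
      finally show ?thesis by (simp add: m(1) m_def)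
    next
      case 2
      then show ?thesis by (simp add: vac_nprod a c nprod_closed nprod_zero_right)
    next
      case 3
      define m where "m = nat (n - 1)"
      have m: "nat (-1 - n) = 0" "n = 1 + int m" using 3 by (auto simp: m_def)
      have "sum ?t {0, m} = ?t m"
      proof (cases "m = 0")
        case False
        then show ?thesis using m by (simp add: vac_nprod a c nprod_closed nprod_zero_right)
      qed simp
      also have "\<dots> = scl V (- of_int n) (nprod V a (n - 1) c)"
        using m by (simp add: vac_nprod a c nprod_closed nprod_zero_right
            scale_left_diff_distrib scale_left_distrib)
      finally show ?thesis by (simp add: m(1) m_def)
    qed
  qed
  finally show ?thesis .
qed

end

section \<open>Graded components\<close>

context graded_vertex_algebra
begin

lemma grade_closed: "v \<in> grade V n \<Longrightarrow> v \<in> carrier V"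
  using grade_subset by blast

lemma zero_grade: "0 \<in> grade V n"
  using grade_subspace subspace_0 by blast

lemma homogeneous_decomp_pr:
  assumes "v \<in> carrier V"
  shows "homogeneous_decomp V v (\<lambda>n. pr V n v)"
  unfolding pr_def using theI'[OF direct_sum[OF assms]] by simp

lemma pr_grade: "v \<in> carrier V \<Longrightarrow> pr V n v \<in> grade V n"
  using homogeneous_decomp_pr unfolding homogeneous_decomp_def by blast

lemma pr_closed: "v \<in> carrier V \<Longrightarrow> pr V n v \<in> carrier V"
  using pr_grade grade_closed by blast

lemma finite_support: "v \<in> carrier V \<Longrightarrow> finite {n. pr V n v \<noteq> 0}"
  using homogeneous_decomp_pr unfolding homogeneous_decomp_def by blast

lemma sum_pr:
  assumes "v \<in> carrier V" "finite S" "{n. pr V n v \<noteq> 0} \<subseteq> S"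
  shows "(\<Sum>n\<in>S. pr V n v) = v"
  using homogeneous_decomp_pr[OF assms(1)] assms
  unfolding homogeneous_decomp_def by (simp add: Sum_any.expand_superset)

lemma pr_eqI:
  assumes "v \<in> carrier V" "homogeneous_decomp V v x"
  shows "pr V n v = x n"
  using direct_sum[OF assms(1)] assms(2) homogeneous_decomp_pr[OF assms(1)] by metis

lemma pr_sum_homogeneous:
  assumes "finite S" "\<And>i. i \<in> S \<Longrightarrow> x i \<in> grade V i"
  shows "pr V n (sum x S) = (if n \<in> S then x n else 0)"
proof (rule pr_eqI)
  show "sum x S \<in> carrier V" using assms grade_closed by (intro sum_closed) blast
  have "{i. (if i \<in> S then x i else 0) \<noteq> 0} \<subseteq> S" by auto
  then have "Sum_any (\<lambda>i. if i \<in> S then x i else 0) = (\<Sum>i\<in>S. if i \<in> S then x i else 0)"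
    by (intro Sum_any.expand_superset assms(1))
  then show "homogeneous_decomp V (sum x S) (\<lambda>n. if n \<in> S then x n else 0)"
    unfolding homogeneous_decomp_def using assms
    by (auto simp: zero_grade intro: finite_subset)
qed

lemma pr_homogeneous: "v \<in> grade V m \<Longrightarrow> pr V n v = (if n = m then v else 0)"
  using pr_sum_homogeneous[of "{m}" "\<lambda>_. v" n] by auto

lemma pr_add:
  assumes "u \<in> carrier V" "v \<in> carrier V"
  shows "pr V n (u + v) = pr V n u + pr V n v"
proof -
  define S where "S = {n. pr V n u \<noteq> 0} \<union> {n. pr V n v \<noteq> 0} \<union> {n}"
  have S: "finite S" using assms finite_support by (auto simp: S_def)
  have "u + v = (\<Sum>k\<in>S. pr V k u + pr V k v)"
    using sum_pr[OF assms(1) S] sum_pr[OF assms(2) S]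
    by (simp add: sum.distrib S_def le_supI1 subset_insertI2)
  moreover have "pr V n (\<Sum>k\<in>S. pr V k u + pr V k v) = (if n \<in> S then pr V n u + pr V n v else 0)"
    using S assms by (intro pr_sum_homogeneous) (auto intro!: subspace_add[OF grade_subspace] pr_grade)
  ultimately show ?thesis by (simp add: S_def)
qed

lemma pr_zero: "pr V n 0 = 0"
  using pr_homogeneous[OF zero_grade] by (metis)

lemma pr_scl:
  assumes "v \<in> carrier V"
  shows "pr V n (scl V c v) = scl V c (pr V n v)"
proof -
  define S where "S = {n. pr V n v \<noteq> 0} \<union> {n}"
  have S: "finite S" using assms finite_support by (auto simp: S_def)
  have "scl V c v = (\<Sum>k\<in>S. scl V c (pr V k v))"
    using sum_pr[OF assms S] by (subst scale_sum_right[symmetric]) (simp add: S_def subset_insertI)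
  moreover have "pr V n (\<Sum>k\<in>S. scl V c (pr V k v)) = (if n \<in> S then scl V c (pr V n v) else 0)"
    using S assms by (intro pr_sum_homogeneous) (auto intro!: subspace_scale[OF grade_subspace] pr_grade)
  ultimately show ?thesis by (simp add: S_def)
qed

lemma pr_diff:
  assumes "u \<in> carrier V" "v \<in> carrier V"
  shows "pr V n (u - v) = pr V n u - pr V n v"
  using pr_add[of "u - v" v n] assms diff_closed by simp

lemma pr_sum:
  assumes "\<And>i. i \<in> S \<Longrightarrow> x i \<in> carrier V"
  shows "pr V n (sum x S) = (\<Sum>i\<in>S. pr V n (x i))"
  using assms
  by (induction S rule: infinite_finite_induct) (auto simp: pr_zero pr_add sum_closed)

lemma eq_if_pr_eq:
  assumes "u \<in> carrier V" "v \<in> carrier V" "\<And>n. pr V n u = pr V n v"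
  shows "u = v"
proof -
  have "u = (\<Sum>n | pr V n u \<noteq> 0. pr V n u)"
    by (rule sum_pr[OF assms(1) finite_support[OF assms(1)] order_refl, symmetric])
  also have "\<dots> = (\<Sum>n | pr V n v \<noteq> 0. pr V n v)" by (simp only: assms(3))
  also have "\<dots> = v" by (rule sum_pr[OF assms(2) finite_support[OF assms(2)] order_refl])
  finally show ?thesis .
qed

lemma pr_nprod_homogeneous_left:
  assumes a: "a \<in> grade V n" and v: "v \<in> carrier V"
  shows "pr V k (nprod V a p v) = nprod V a p (pr V (k - n + p + 1) v)"
proof -
  define S where "S = {n. pr V n v \<noteq> 0}"
  have S: "finite S" using v finite_support by (auto simp: S_def)
  have "pr V k (nprod V a p v) = pr V k (\<Sum>l\<in>S. nprod V a p (pr V l v))"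
    using sum_pr[OF v S] a v
    by (subst nprod_sum_right[symmetric]) (auto simp: S_def grade_closed pr_closed)
  also have "\<dots> = (\<Sum>l\<in>S. pr V k (nprod V a p (pr V l v)))"
    using a v by (intro pr_sum nprod_closed grade_closed[OF a] pr_closed)
  also have "\<dots> = (\<Sum>l\<in>S. if l = k - n + p + 1 then nprod V a p (pr V l v) else 0)"
    using pr_homogeneous[OF grade_nprod[OF a pr_grade[OF v]]]
    by (intro sum.cong) auto
  also have "\<dots> = nprod V a p (pr V (k - n + p + 1) v)"
    using S a by (simp add: S_def nprod_zero_right grade_closed)
  finally show ?thesis .
qed

lemma pr_nprod:
  assumes a: "a \<in> carrier V" and v: "v \<in> carrier V"
    and S: "finite S" "{n. pr V n a \<noteq> 0} \<subseteq> S"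
  shows "pr V k (nprod V a p v) = (\<Sum>n\<in>S. nprod V (pr V n a) p (pr V (k - n + p + 1) v))"
proof -
  have "pr V k (nprod V a p v) = pr V k (\<Sum>n\<in>S. nprod V (pr V n a) p v)"
    using sum_pr[OF a S] a v
    by (subst nprod_sum_left[symmetric]) (auto simp: pr_closed)
  also have "\<dots> = (\<Sum>n\<in>S. pr V k (nprod V (pr V n a) p v))"
    using a v by (intro pr_sum) (auto intro!: nprod_closed pr_closed)
  also have "\<dots> = (\<Sum>n\<in>S. nprod V (pr V n a) p (pr V (k - n + p + 1) v))"
    using pr_nprod_homogeneous_left[OF pr_grade[OF a] v] by simp
  finally show ?thesis .
qed

text \<open>If a mode of \<open>a\<close> vanishes as an operator, so does that mode of each component of \<open>a\<close>, because
  the components shift the degree by different amounts.\<close>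

lemma nprod_pr_eq_zero:
  assumes a: "a \<in> carrier V" and zero: "\<And>v. v \<in> carrier V \<Longrightarrow> nprod V a p v = 0"
    and v: "v \<in> carrier V"
  shows "nprod V (pr V n a) p v = 0"
proof -
  have *: "nprod V (pr V n a) p (pr V l v) = 0" for l
  proof -
    define S where "S = insert n {n. pr V n a \<noteq> 0}"
    have S: "finite S" using a finite_support by (auto simp: S_def)
    have "0 = pr V (l + n - p - 1) (nprod V a p (pr V l v))"
      using zero[OF pr_closed[OF v]] by (simp add: pr_zero)
    also have "\<dots> = (\<Sum>m\<in>S. nprod V (pr V m a) p (pr V (l + n - p - 1 - m + p + 1) (pr V l v)))"
      using S by (intro pr_nprod a pr_closed v) (auto simp: S_def)
    also have "\<dots> = (\<Sum>m\<in>S. if m = n then nprod V (pr V m a) p (pr V l v) else 0)"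
      by (intro sum.cong) (auto simp: pr_homogeneous[OF pr_grade[OF v]] nprod_zero_right pr_closed a)
    also have "\<dots> = nprod V (pr V n a) p (pr V l v)"
      using S by (simp add: S_def)
    finally show ?thesis by simp
  qed
  have "nprod V (pr V n a) p v = (\<Sum>l | pr V l v \<noteq> 0. nprod V (pr V n a) p (pr V l v))"
    using sum_pr[OF v finite_support[OF v]] a v
    by (subst nprod_sum_right[symmetric]) (auto simp: pr_closed)
  then show ?thesis by (simp add: *)
qed

text \<open>The increasing filtration by the sums of the components of degree at most a given bound.\<close>

definition upto :: "int \<Rightarrow> 'v set"
  where "upto M = {v \<in> carrier V. \<forall>n>M. pr V n v = 0}"

lemma upto_closed: "v \<in> upto M \<Longrightarrow> v \<in> carrier V"
  by (simp add: upto_def)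

lemma grade_subset_upto: "n \<le> M \<Longrightarrow> v \<in> grade V n \<Longrightarrow> v \<in> upto M"
  by (auto simp: upto_def grade_closed pr_homogeneous)

lemma upto_mono: "m \<le> n \<Longrightarrow> v \<in> upto m \<Longrightarrow> v \<in> upto n"
  by (auto simp: upto_def)

lemma subspace_upto: "subspace (upto M)"
  by (rule subspaceI) (auto simp: upto_def pr_zero pr_add pr_scl closed)

lemma upto_eq_span: "upto M = span (\<Union>k\<in>{..M}. grade V k)"
proof (intro equalityI subsetI)
  fix v assume v: "v \<in> upto M"
  have "v = (\<Sum>n | pr V n v \<noteq> 0. pr V n v)"
    using sum_pr finite_support upto_closed[OF v] by simp
  also have "\<dots> \<in> span (\<Union>k\<in>{..M}. grade V k)"
  proof (intro span_sum span_base)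
    fix n assume "n \<in> {n. pr V n v \<noteq> 0}"
    then have "n \<le> M" using v by (force simp: upto_def)
    then show "pr V n v \<in> (\<Union>k\<in>{..M}. grade V k)" using pr_grade[OF upto_closed[OF v]] by blast
  qed
  finally show "v \<in> span (\<Union>k\<in>{..M}. grade V k)" .
next
  fix v assume "v \<in> span (\<Union>k\<in>{..M}. grade V k)"
  then show "v \<in> upto M"
    using span_minimal[OF _ subspace_upto, of "\<Union>k\<in>{..M}. grade V k" M] grade_subset_upto by blast
qed

text \<open>Products of leading components are leading components of products.\<close>

lemma pr_nprod_upto:
  assumes x: "x \<in> upto k" and y: "y \<in> upto l"
  shows "pr V (k + l - n - 1) (nprod V x n y) = nprod V (pr V k x) n (pr V l y)"
proof -
  define S where "S = insert k {n. pr V n x \<noteq> 0}"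
  have S: "finite S" using x finite_support upto_closed by (auto simp: S_def)
  have "pr V (k + l - n - 1) (nprod V x n y)
      = (\<Sum>j\<in>S. nprod V (pr V j x) n (pr V (k + l - n - 1 - j + n + 1) y))"
    using S x y by (intro pr_nprod) (auto simp: S_def upto_closed)
  also have "\<dots> = (\<Sum>j\<in>S. if j = k then nprod V (pr V k x) n (pr V l y) else 0)"
  proof (intro sum.cong refl)
    fix j
    have "k + l - n - 1 - j + n + 1 = k + l - j" by simp
    then have "pr V (k + l - n - 1 - j + n + 1) y = pr V (k + l - j) y" by (rule arg_cong)
    moreover have "pr V (k + l - j) y = 0" if "j < k" using y that by (simp add: upto_def)
    moreover have "pr V j x = 0" if "j > k" using x that by (simp add: upto_def)
    ultimately show "nprod V (pr V j x) n (pr V (k + l - n - 1 - j + n + 1) y)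
      = (if j = k then nprod V (pr V k x) n (pr V l y) else 0)"
      using x y by (cases j k rule: linorder_cases)
        (simp_all only: nprod_zero_left nprod_zero_right pr_closed upto_closed, auto)
  qed
  also have "\<dots> = nprod V (pr V k x) n (pr V l y)" using S by (simp add: S_def)
  finally show ?thesis .
qed

end

section \<open>Conformal vertex algebras\<close>

context conformal_vertex_algebra
begin

abbreviation T :: "'v \<Rightarrow> 'v" where "T \<equiv> Vir V (-1)"
abbreviation L1 :: "'v \<Rightarrow> 'v" where "L1 \<equiv> Vir V 1"

lemma conf_closed: "conf V \<in> carrier V"
  using conf_grade grade_closed by blast

lemma Vir_closed: "v \<in> carrier V \<Longrightarrow> Vir V n v \<in> carrier V"
  by (simp add: Vir_def nprod_closed conf_closed)

lemma Vir_add: "u \<in> carrier V \<Longrightarrow> v \<in> carrier V \<Longrightarrow> Vir V n (u + v) = Vir V n u + Vir V n v"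
  by (simp add: Vir_def nprod_add_right conf_closed)

lemma Vir_diff: "u \<in> carrier V \<Longrightarrow> v \<in> carrier V \<Longrightarrow> Vir V n (u - v) = Vir V n u - Vir V n v"
  by (simp add: Vir_def nprod_diff_right conf_closed)

lemma Vir_scl: "v \<in> carrier V \<Longrightarrow> Vir V n (scl V c v) = scl V c (Vir V n v)"
  by (simp add: Vir_def nprod_scl_right conf_closed)

lemma Vir_zero: "Vir V n 0 = 0"
  by (simp add: Vir_def nprod_zero_right conf_closed)

lemma Vir_sum:
  "(\<And>i. i \<in> S \<Longrightarrow> x i \<in> carrier V) \<Longrightarrow> Vir V n (sum x S) = (\<Sum>i\<in>S. Vir V n (x i))"
  by (simp add: Vir_def nprod_sum_right conf_closed)

lemma Vir_grade: "v \<in> grade V m \<Longrightarrow> Vir V n v \<in> grade V (m - n)"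
  using grade_nprod[OF conf_grade, of v m "n + 1"] by (simp add: Vir_def algebra_simps)

lemma pr_Vir: "v \<in> carrier V \<Longrightarrow> pr V k (Vir V n v) = Vir V n (pr V (k + n) v)"
  using pr_nprod_homogeneous_left[OF conf_grade, of v k "n + 1"] by (simp add: Vir_def algebra_simps)

lemma pr_L0: "v \<in> carrier V \<Longrightarrow> pr V n (Vir V 0 v) = scl V (of_int n) (pr V n v)"
  using pr_Vir[of v n 0] L0_grade[OF pr_grade] by simp

lemma grade_if_L0_eigenvector:
  assumes v: "v \<in> carrier V" and eig: "Vir V 0 v = scl V (of_int n) v"
  shows "v \<in> grade V n"
proof -
  have zero: "pr V k v = 0" if "k \<noteq> n" for k
  proof -
    have "scl V (of_int k) (pr V k v) = scl V (of_int n) (pr V k v)"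
      using pr_L0[OF v, of k] eig pr_scl[OF v, of k "of_int n"] by argo
    then show ?thesis using that by simp
  qed
  then have "{k. pr V k v \<noteq> 0} \<subseteq> {n}" by blast
  then have "v = pr V n v"
    using sum_pr[OF v, of "{n}"] by simp
  then show ?thesis using pr_grade[OF v, of n] by simp
qed

lemma nprod_T: "\<lbrakk>a \<in> carrier V; c \<in> carrier V\<rbrakk> \<Longrightarrow> nprod V (T a) n c = scl V (- of_int n) (nprod V a (n - 1) c)"
  using nprod_translation translation by simp

lemma T_nprod:
  assumes "a \<in> carrier V" "c \<in> carrier V"
  shows "T (nprod V a n c) = scl V (- of_int n) (nprod V a (n - 1) c) + nprod V a n (T c)"
proof -
  have "T (nprod V a n c) - nprod V a n (T c) = nprod V (T a) n c"
    using commutator[OF conf_closed assms, of 0 n]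
    by (subst (asm) Sum_any.expand_superset[of "{0}"]) (auto simp: Vir_def gbinomial_0_left)
  then show ?thesis using nprod_T[OF assms] by (simp add: algebra_simps)
qed

lemma T_vac: "T (vac V) = 0"
  using translation[OF vac_closed] vac_nprod[OF vac_closed, of "-2"] by simp

lemma L1_T: 
  assumes "v \<in> grade V n"
  shows "L1 (T v) = T (L1 v) + scl V (of_int (2 * n)) v"
proof -
  obtain c where "\<forall>n m. \<forall>v\<in>carrier V. Vir V n (Vir V m v) - Vir V m (Vir V n v) =
      scl V (of_int (n - m)) (Vir V (n + m) v)
      + scl V (if n + m = 0 then of_int (n ^ 3 - n) / 12 * c else 0) v"
    using virasoro by blast
  from this[rule_format, of v 1 "-1"] assms show ?thesis
    by (simp add: grade_closed L0_grade algebra_simps)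
qed

text \<open>For quasi-primary \<open>a\<close> of degree \<open>n\<close>, the modes \<open>a(0), \<dots>, a(2n-2)\<close> form a
  finite-dimensional \<open>sl\<^sub>2\<close>-module under the adjoint action of \<open>L(-1)\<close>, \<open>L(0)\<close>, \<open>L(1)\<close>.\<close>

lemma L1_quasi_primary_mode:
  assumes a: "a \<in> grade V n" "L1 a = 0" and c: "c \<in> carrier V"
  shows "L1 (nprod V a k c) = nprod V a k (L1 c) + scl V (of_int (2 * n - 2 - k)) (nprod V a (k + 1) c)"
proof -
  note ac = grade_closed[OF a(1)] c
  have "L1 (nprod V a k c) - nprod V a k (L1 c) = Sum_any (\<lambda>i::nat. scl V (of_int 2 gchoose i)
      (nprod V (nprod V (conf V) (int i) a) (2 + k - int i) c))"
    using commutator[OF conf_closed ac, of 2 k] by (simp add: Vir_def)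
  also have "\<dots> = (\<Sum>i\<le>2. scl V (of_nat (2 choose i))
      (nprod V (nprod V (conf V) (int i) a) (2 + k - int i) c))"
  proof -
    have "((of_int 2 :: 'k) gchoose i) = of_nat (2 choose i)" for i
      by (simp add: binomial_gbinomial)
    moreover have "i \<le> 2" if "of_nat (2 choose i) \<noteq> (0 :: 'k)" for i
      using that by (rule contrapos_np) (simp add: binomial_eq_0)
    ultimately show ?thesis
      by (subst Sum_any.expand_superset[of "{..2}"]) auto
  qed
  also have "\<dots> = nprod V (T a) (k + 2) c + scl V 2 (nprod V (Vir V 0 a) (k + 1) c) + nprod V (L1 a) k c"
    by (simp add: numeral_2_eq_2 Vir_def algebra_simps)
  also have "\<dots> = scl V (of_int (2 * n - 2 - k)) (nprod V a (k + 1) c)"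
    using a ac by (simp add: nprod_T L0_grade nprod_scl_left nprod_zero_left algebra_simps)
  finally show ?thesis by (simp add: algebra_simps)
qed

end

section \<open>Automorphisms\<close>

context vertex_algebra
begin

lemma aut_closed: "f \<in> va_auts V \<Longrightarrow> v \<in> carrier V \<Longrightarrow> f v \<in> carrier V"
  by (auto simp: va_auts_def dest: Bij_imp_funcset)

lemma aut_add: "f \<in> va_auts V \<Longrightarrow> u \<in> carrier V \<Longrightarrow> v \<in> carrier V \<Longrightarrow> f (u + v) = f u + f v"
  by (simp add: va_auts_def)

lemma aut_scl: "f \<in> va_auts V \<Longrightarrow> v \<in> carrier V \<Longrightarrow> f (scl V k v) = scl V k (f v)"
  by (simp add: va_auts_def)

lemma aut_nprod:
  "f \<in> va_auts V \<Longrightarrow> a \<in> carrier V \<Longrightarrow> b \<in> carrier V \<Longrightarrow> f (nprod V a n b) = nprod V (f a) n (f b)"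
  by (simp add: va_auts_def)

lemma aut_vac: "f \<in> va_auts V \<Longrightarrow> f (vac V) = vac V"
  by (simp add: va_auts_def)

lemma aut_zero: "f \<in> va_auts V \<Longrightarrow> f 0 = 0"
  using aut_add[of f 0 0] zero_closed by simp

lemma aut_diff:
  "f \<in> va_auts V \<Longrightarrow> u \<in> carrier V \<Longrightarrow> v \<in> carrier V \<Longrightarrow> f (u - v) = f u - f v"
  using aut_add[of f "u - v" v] diff_closed by simp

lemma aut_sum:
  assumes "f \<in> va_auts V" "\<And>i. i \<in> S \<Longrightarrow> x i \<in> carrier V"
  shows "f (sum x S) = (\<Sum>i\<in>S. f (x i))"
  using assms(2)
  by (induction S rule: infinite_finite_induct) (auto simp: aut_zero aut_add assms(1) sum_closed)

lemma aut_eqI: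
  assumes "f \<in> va_auts V" "g \<in> va_auts V" "\<And>v. v \<in> carrier V \<Longrightarrow> f v = g v"
  shows "f = g"
  using assms by (intro extensionalityI[of f "carrier V"]) (auto simp: va_auts_def Bij_def)

lemma id_aut: "restrict id (carrier V) \<in> va_auts V"
  using id_Bij[of "carrier V"] by (simp add: va_auts_def closed id_def)

lemma compose_aut:
  assumes "f \<in> va_auts V" "g \<in> va_auts V"
  shows "compose (carrier V) f g \<in> va_auts V"
proof -
  have "compose (carrier V) f g \<in> Bij (carrier V)"
    using assms by (intro compose_Bij) (auto simp: va_auts_def)
  then show ?thesis
    unfolding va_auts_def
    by (simp add: compose_eq closed assms[THEN aut_closed] assms[THEN aut_add] assms[THEN aut_scl]
        assms[THEN aut_nprod] assms[THEN aut_vac])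
qed

lemma inverse_aut:
  assumes f: "f \<in> va_auts V"
  obtains g where "g \<in> va_auts V"
    "\<And>v. v \<in> carrier V \<Longrightarrow> g (f v) = v" "\<And>v. v \<in> carrier V \<Longrightarrow> f (g v) = v"
proof -
  define g where "g = restrict (inv_into (carrier V) f) (carrier V)"
  have bij: "bij_betw f (carrier V) (carrier V)" using f by (simp add: va_auts_def Bij_def)
  have gB: "g \<in> Bij (carrier V)"
    unfolding g_def using f by (intro restrict_inv_into_Bij) (simp add: va_auts_def)
  then have gc: "g v \<in> carrier V" if "v \<in> carrier V" for v using that Bij_imp_funcset by fastforce
  have gf: "g (f v) = v" if "v \<in> carrier V" for v
    using that bij aut_closed[OF f] by (simp add: g_def bij_betw_inv_into_left)
  have fg: "f (g v) = v" if "v \<in> carrier V" for v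
    using that bij by (simp add: g_def bij_betw_inv_into_right)
  have "g (u + v) = g u + g v" if "u \<in> carrier V" "v \<in> carrier V" for u v
    using gf[of "g u + g v"] that by (simp add: gc closed aut_add[OF f] fg)
  moreover have "g (scl V k v) = scl V k (g v)" if "v \<in> carrier V" for k v
    using gf[of "scl V k (g v)"] that by (simp add: gc closed aut_scl[OF f] fg)
  moreover have "g (nprod V a n b) = nprod V (g a) n (g b)" if "a \<in> carrier V" "b \<in> carrier V" for a b n
    using gf[of "nprod V (g a) n (g b)"] that by (simp add: gc closed aut_nprod[OF f] fg)
  moreover have "g (vac V) = vac V" using gf[OF vac_closed] by (simp add: aut_vac[OF f])
  ultimately have "g \<in> va_auts V" using gB by (simp add: va_auts_def)
  from this gf fg show thesis by (rule that)
qed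

lemma Aut_simps:
  shows carrier_Aut: "carrier (Aut V) = va_auts V"
    and mult_Aut: "\<lbrakk>f \<in> va_auts V; g \<in> va_auts V\<rbrakk> \<Longrightarrow> f \<otimes>\<^bsub>Aut V\<^esub> g = compose (carrier V) f g"
    and one_Aut: "\<one>\<^bsub>Aut V\<^esub> = restrict id (carrier V)"
  by (auto simp: Aut_def BijGroup_def va_auts_def id_def)

lemma group_Aut: "group (Aut V)"
proof (rule groupI)
  fix f g h assume fgh: "f \<in> carrier (Aut V)" "g \<in> carrier (Aut V)" "h \<in> carrier (Aut V)"
  then show "f \<otimes>\<^bsub>Aut V\<^esub> g \<otimes>\<^bsub>Aut V\<^esub> h = f \<otimes>\<^bsub>Aut V\<^esub> (g \<otimes>\<^bsub>Aut V\<^esub> h)"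
    by (intro aut_eqI) (auto simp: Aut_simps compose_aut compose_eq aut_closed)
next
  fix f assume f: "f \<in> carrier (Aut V)"
  then obtain g where g: "g \<in> va_auts V" "\<And>v. v \<in> carrier V \<Longrightarrow> g (f v) = v"
    by (auto simp: Aut_simps elim: inverse_aut)
  have "g \<otimes>\<^bsub>Aut V\<^esub> f = \<one>\<^bsub>Aut V\<^esub>"
    using f g by (intro aut_eqI) (auto simp: Aut_simps compose_aut compose_eq id_aut)
  then show "\<exists>g\<in>carrier (Aut V). g \<otimes>\<^bsub>Aut V\<^esub> f = \<one>\<^bsub>Aut V\<^esub>"
    using g by (auto simp: Aut_simps)
  show "\<one>\<^bsub>Aut V\<^esub> \<otimes>\<^bsub>Aut V\<^esub> f = f"
    using f by (intro aut_eqI) (auto simp: Aut_simps compose_aut compose_eq id_aut aut_closed)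
qed (auto simp: Aut_simps compose_aut id_aut)

end

context conformal_vertex_algebra
begin

text \<open>The operator \<open>f(\<omega>)(1)\<close> is the conjugate of \<open>L(0)\<close> by \<open>f\<close>, hence diagonalizable.\<close>

lemma aut_conf_eigenvector:
  assumes f: "f \<in> va_auts V" and v: "v \<in> grade V n"
  shows "nprod V (f (conf V)) 1 (f v) = scl V (of_int n) (f v)"
  using L0_grade[OF v] aut_nprod[OF f conf_closed, of v 1] aut_scl[OF f] grade_closed[OF v]
  by (simp add: Vir_def)

text \<open>A finite sum of eigenvectors of \<open>X\<close> with integral eigenvalues is annihilated by a product of
  factors \<open>X - c\<close>.\<close>

lemma fold_diagonalizable:
  assumes lin: "\<And>u v. u \<in> carrier V \<Longrightarrow> v \<in> carrier V \<Longrightarrow> X (u + v) = X u + X v"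
      "\<And>c v. v \<in> carrier V \<Longrightarrow> X (scl V c v) = scl V c (X v)"
    and "finite S"
    and "\<And>k. k \<in> S \<Longrightarrow> e k \<in> carrier V \<and> X (e k) = scl V (of_int k) (e k)"
  shows "\<exists>cs. fold (\<lambda>c u. X u - scl V (of_int c) u) cs (sum e S) = 0"
  using assms(3,4)
proof (induction S arbitrary: e rule: finite_induct)
  case empty
  then show ?case by (auto intro: exI[of _ "[]"])
next
  case (insert c S)
  have "X 0 = 0" using lin(1)[of 0 0] zero_closed by simp
  moreover have "sum e F \<in> carrier V" if "F \<subseteq> insert c S" for F
    using that insert.prems by (intro sum_closed) blast
  ultimately have Xsum: "X (sum e S') = (\<Sum>k\<in>S'. scl V (of_int k) (e k))" if "S' \<subseteq> insert c S" for S'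
    using that insert.prems finite_subset[OF that] insert.hyps(1)
    by (induction S' rule: infinite_finite_induct) (auto simp: lin closed)
  have e: "scl V (of_int (k - c)) (e k) \<in> carrier V \<and>
    X (scl V (of_int (k - c)) (e k)) = scl V (of_int k) (scl V (of_int (k - c)) (e k))" if "k \<in> S" for k
    using insert.prems[of k] that by (simp add: lin closed mult.commute)
  obtain cs where cs: "fold (\<lambda>c u. X u - scl V (of_int c) u) cs (\<Sum>k\<in>S. scl V (of_int (k - c)) (e k)) = 0"
    using insert.IH[OF e] by blast
  have "X (sum e (insert c S)) - scl V (of_int c) (sum e (insert c S))
    = (\<Sum>k\<in>S. scl V (of_int (k - c)) (e k))"
    using insert.hyps
    by (subst Xsum) (simp_all add: scale_sum_right scale_right_distrib scale_left_diff_distrib sum_subtractf)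
  then show ?case using cs by (intro exI[of _ "c # cs"]) simp
qed

lemma fold_aut_conf:
  assumes f: "f \<in> va_auts V" and v: "v \<in> carrier V"
  shows "\<exists>cs. fold (\<lambda>c u. nprod V (f (conf V)) 1 u - scl V (of_int c) u) cs v = 0"
proof -
  obtain g where g: "g \<in> va_auts V" "\<And>v. v \<in> carrier V \<Longrightarrow> f (g v) = v"
    using inverse_aut[OF f] by metis
  have gv: "g v \<in> carrier V" using aut_closed g v by blast
  define S where "S = {n. pr V n (g v) \<noteq> 0}"
  have S: "finite S" "(\<Sum>n\<in>S. pr V n (g v)) = g v"
    using finite_support[OF gv] sum_pr[OF gv] by (auto simp: S_def)
  have "v = (\<Sum>n\<in>S. f (pr V n (g v)))"
    using aut_sum[OF f, of S "\<lambda>n. pr V n (g v)"] S(2) g(2)[OF v] pr_closed[OF gv] by simp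
  moreover have "\<exists>cs. fold (\<lambda>c u. nprod V (f (conf V)) 1 u - scl V (of_int c) u) cs
      (\<Sum>n\<in>S. f (pr V n (g v))) = 0"
    using S(1) by (intro fold_diagonalizable)
      (auto simp: nprod_add_right nprod_scl_right aut_closed f conf_closed gv pr_closed
        intro!: aut_conf_eigenvector pr_grade)
  ultimately show ?thesis by simp
qed

text \<open>An automorphism commutes with \<open>T\<close>, which is the zero mode of every conformal vector.\<close>

lemma aut_conf_zero_mode:
  assumes f: "f \<in> va_auts V" and v: "v \<in> carrier V"
  shows "nprod V (f (conf V) - conf V) 0 v = 0"
proof -
  obtain g where g: "g \<in> va_auts V" "\<And>v. v \<in> carrier V \<Longrightarrow> f (g v) = v"
    using inverse_aut[OF f] by metis
  have gv: "g v \<in> carrier V" using aut_closed g v by blast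
  have "f (T (g v)) = T v"
    using translation[OF gv] translation[OF v] aut_nprod[OF f gv vac_closed] aut_vac[OF f] g(2)[OF v] by simp
  then have "nprod V (f (conf V)) 0 v = T v"
    using aut_nprod[OF f conf_closed gv, of 0] g(2)[OF v] by (simp add: Vir_def)
  then show ?thesis
    using nprod_diff_left[OF aut_closed[OF f conf_closed] conf_closed v, of 0] by (simp add: Vir_def)
qed

text \<open>Skew-symmetry turns \<open>a(0)\<omega> = 0\<close> into \<open>(n - 1) T a \<in> T\<^sup>2 V\<^sub>n\<^sub>-\<^sub>1\<close>.\<close>

lemma central_zero_mode:
  assumes a: "a \<in> grade V n" and n: "n \<noteq> 1" and zero: "\<And>v. v \<in> carrier V \<Longrightarrow> nprod V a 0 v = 0"
  shows "\<exists>y\<in>grade V (n - 1). T a = - T (T y)"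
proof -
  note ac = grade_closed[OF a]
  define S where "S = (\<lambda>y. T (T y)) ` grade V (n - 1)"
  have S: "subspace S"
    unfolding S_def
  proof (intro subspaceI)
    show "0 \<in> (\<lambda>y. T (T y)) ` grade V (n - 1)"
      using zero_grade by (intro image_eqI[of _ _ 0]) (auto simp: Vir_zero)
    fix x y c assume "x \<in> (\<lambda>y. T (T y)) ` grade V (n - 1)" "y \<in> (\<lambda>y. T (T y)) ` grade V (n - 1)"
    then obtain x' y' where *: "x' \<in> grade V (n - 1)" "y' \<in> grade V (n - 1)" "x = T (T x')" "y = T (T y')"
      by blast
    then show "x + y \<in> (\<lambda>y. T (T y)) ` grade V (n - 1)"
      by (intro image_eqI[of _ _ "x' + y'"])
        (auto simp: Vir_add Vir_closed grade_closed intro: subspace_add[OF grade_subspace])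
    show "scl V c x \<in> (\<lambda>y. T (T y)) ` grade V (n - 1)"
      using * by (intro image_eqI[of _ _ "scl V c x'"])
        (auto simp: Vir_scl Vir_closed grade_closed intro: subspace_scale[OF grade_subspace])
  qed
  obtain N where N: "\<forall>n\<ge>N. nprod V (conf V) n a = 0" using truncation[OF conf_closed ac] by blast
  define M where "M = nat N"
  have M: "nprod V (conf V) m a = 0" if "m \<ge> 0 + int (Suc (Suc M))" for m
  proof -
    have "m \<ge> N" using that unfolding M_def by linarith
    then show ?thesis using N by blast
  qed
  define x where "x i = nprod V (conf V) (int i) a" for i
  have xc: "x i \<in> carrier V" for i by (simp add: x_def nprod_closed conf_closed ac)
  have "0 = nprod V a 0 (conf V)" using zero[OF conf_closed] by simp
  also have "\<dots> = (\<Sum>i<Suc (Suc M). scl V ((-1) powi (0 + int i + 1)) (nprod V (x i) (-1 - int i) (vac V)))"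
    unfolding x_def
    using skew_symmetry[where r = 0 and M = "Suc (Suc M)", OF conf_closed ac] M by simp
  also have "\<dots> = - x 0 + nprod V (x 1) (-2) (vac V) +
     (\<Sum>i<M. scl V ((-1) powi (3 + int i)) (nprod V (x (Suc (Suc i))) (- int i - 3) (vac V)))"
    by (simp only: sum.lessThan_Suc_shift)
      (simp add: vac_right xc algebra_simps power_int_minus)
  also have "x 0 = T a" by (simp add: x_def Vir_def)
  also have "nprod V (x 1) (-2) (vac V) = scl V (of_int n) (T a)"
    using L0_grade[OF a] translation[OF ac] by (simp add: x_def Vir_def nprod_scl_left ac vac_closed)
  finally have "scl V (of_int (1 - n)) (T a)
     = (\<Sum>i<M. scl V ((-1) powi (3 + int i)) (nprod V (x (Suc (Suc i))) (- int i - 3) (vac V)))"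
    by (simp add: algebra_simps)
  also have "\<dots> \<in> S"
  proof (intro subspace_sum[OF S] subspace_scale[OF S])
    fix i
    let ?x = "x (Suc (Suc i))" and ?c = "(2 + of_nat i) * (1 + of_nat i) :: 'k"
    define y where "y = scl V (1 / ?c) (nprod V ?x (-1 - int i) (vac V))"
    have T: "T (nprod V ?x m (vac V)) = scl V (- of_int m) (nprod V ?x (m - 1) (vac V))" for m
      using T_nprod[OF xc vac_closed] by (simp add: T_vac nprod_zero_right xc)
    have c: "?c \<noteq> 0"
      using of_nat_neq_0[of "Suc i", where ?'a = 'k] of_nat_neq_0[of "i", where ?'a = 'k]
      by (simp add: add.commute)
    have T1: "T (nprod V ?x (-1 - int i) (vac V)) = scl V (1 + of_nat i) (nprod V ?x (- int i - 2) (vac V))"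
      using T[of "-1 - int i"] by (simp add: algebra_simps)
    have T2: "T (nprod V ?x (- int i - 2) (vac V)) = scl V (2 + of_nat i) (nprod V ?x (- int i - 3) (vac V))"
      using T[of "- int i - 2"] by (simp add: algebra_simps)
    have "T (T y) = scl V (1 / ?c) (scl V (1 + of_nat i) (scl V (2 + of_nat i) (nprod V ?x (- int i - 3) (vac V))))"
      by (simp only: y_def T1 T2 Vir_scl closed Vir_closed xc)
    also have "\<dots> = scl V (1 / ?c) (scl V ?c (nprod V ?x (- int i - 3) (vac V)))"
      by (simp only: scale_scale mult.commute mult.assoc)
    finally have "nprod V ?x (- int i - 3) (vac V) = T (T y)" using c by simp
    moreover have "?x \<in> grade V (n - 1 - int i)"
      using grade_nprod[OF conf_grade a, of "2 + int i"] by (simp add: x_def algebra_simps)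
    then have "y \<in> grade V (n - 1)"
      using subspace_scale[OF grade_subspace grade_nprod[OF _ vac_grade, of ?x _ "-1 - int i"]]
      by (force simp: y_def)
    ultimately show "nprod V ?x (- int i - 3) (vac V) \<in> S" by (simp add: S_def)
  qed
  finally obtain y where y: "y \<in> grade V (n - 1)" "scl V (of_int (1 - n)) (T a) = T (T y)"
    by (auto simp: S_def)
  have n': "(of_int (1 - n) :: 'k) \<noteq> 0" using n unfolding of_int_eq_0_iff by linarith
  let ?y = "scl V (- (1 / of_int (1 - n))) y"
  have "T (T ?y) = scl V (- (1 / of_int (1 - n))) (T (T y))"
    by (simp only: Vir_scl Vir_closed grade_closed[OF y(1)])
  then have "- T (T ?y) = scl V (1 / of_int (1 - n)) (scl V (of_int (1 - n)) (T a))"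
    unfolding y(2) by simp
  also have "\<dots> = T a" using n' by (simp del: of_int_diff)
  finally have "T a = - T (T ?y)" by (rule sym)
  then show ?thesis using subspace_scale[OF grade_subspace y(1)] by (rule bexI)
qed

text \<open>Under the relation \<open>Ta = -T\<^sup>2y\<close> the modes \<open>a(n)\<close> with \<open>n \<noteq> -1\<close> are those of \<open>-Ty\<close>.\<close>

lemma modes_of_T_eq:
  assumes a: "a \<in> carrier V" and y: "y \<in> carrier V" and eq: "T a = - T (T y)" and v: "v \<in> carrier V"
  shows "nprod V a 1 v = nprod V y 0 v" "nprod V a 2 v = scl V 2 (nprod V y 1 v)"
proof -
  have *: "nprod V (T a) n v = - nprod V (T (T y)) n v" for n
    using nprod_diff_left[OF zero_closed Vir_closed[OF Vir_closed[OF y]] v, of "-1" "-1" n]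
    by (simp add: eq nprod_zero_left v)
  have "scl V (-2) (nprod V a 1 v) = scl V (-2) (nprod V y 0 v)"
    using *[of 2] a y v by (simp add: nprod_T Vir_closed)
  then show "nprod V a 1 v = nprod V y 0 v" by (simp only: scale_left_imp_eq scale_cancel_left) simp
  have "scl V (-3) (nprod V a 2 v) = scl V (-3) (scl V 2 (nprod V y 1 v))"
    using *[of 3] a y v by (simp add: nprod_T Vir_closed)
  then show "nprod V a 2 v = scl V 2 (nprod V y 1 v)" by (simp only: scale_cancel_left) simp
qed

end

section \<open>Positive-definite real vertex operator algebras\<close>

text \<open>The invariance of the form is only required for the modes of quasi-primary vectors, where it
  takes the simple shape of an adjointness relation between \<open>a(p)\<close> and \<open>a(2n-2-p)\<close>.\<close>

locale positive_definite_voa = conformal_vertex_algebra V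
  for V :: "(real, 'v::ab_group_add, 'm) conformal_va_scheme" +
  fixes B :: "'v \<Rightarrow> 'v \<Rightarrow> real"
  assumes grade_neg: "n < 0 \<Longrightarrow> grade V n = {0}"
    and grade_zero: "v \<in> grade V 0 \<Longrightarrow> \<exists>k. v = scl V k (vac V)"
    and L1_grade_one: "v \<in> grade V 1 \<Longrightarrow> Vir V 1 v = 0"
    and B_add: "\<lbrakk>u \<in> carrier V; u' \<in> carrier V; v \<in> carrier V\<rbrakk> \<Longrightarrow> B (u + u') v = B u v + B u' v"
    and B_scl: "\<lbrakk>u \<in> carrier V; v \<in> carrier V\<rbrakk> \<Longrightarrow> B (scl V c u) v = c * B u v"
    and B_sym: "\<lbrakk>u \<in> carrier V; v \<in> carrier V\<rbrakk> \<Longrightarrow> B v u = B u v"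
    and B_pos: "\<lbrakk>v \<in> carrier V; v \<noteq> 0\<rbrakk> \<Longrightarrow> B v v > 0"
    and B_adjoint: "\<lbrakk>a \<in> grade V n; Vir V 1 a = 0; u \<in> carrier V; v \<in> carrier V\<rbrakk>
      \<Longrightarrow> B (nprod V a p u) v = (-1) powi n * B u (nprod V a (2 * n - 2 - p) v)"
begin

lemma B_zero: "v \<in> carrier V \<Longrightarrow> B 0 v = 0" "v \<in> carrier V \<Longrightarrow> B v 0 = 0"
  using B_add[of 0 0 v] B_sym[of v 0] zero_closed by simp_all

lemma B_sum:
  assumes "v \<in> carrier V" "\<And>i. i \<in> S \<Longrightarrow> x i \<in> carrier V"
  shows "B (sum x S) v = (\<Sum>i\<in>S. B (x i) v)"
  using assms(2)
  by (induction S rule: infinite_finite_induct) (auto simp: B_zero B_add assms(1) sum_closed)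

lemma eq_zero_if_B_zero: "v \<in> carrier V \<Longrightarrow> B v v = 0 \<Longrightarrow> v = 0"
  using B_pos by fastforce

text \<open>On \<open>V\<^sub>h\<close> the operator \<open>l + T L(1)\<close> is surjective for \<open>l > 0\<close>; the recursion lowers \<open>h\<close>.\<close>

lemma shifted_T_L1_surj:
  fixes l :: real
  assumes "l > 0" "w \<in> grade V (int h)"
  shows "\<exists>z\<in>grade V (int h). scl V l z + T (L1 z) = w"
  using assms
proof (induction h arbitrary: l w)
  case 0
  have "L1 w = 0" using Vir_grade[of w 0 1] grade_neg[of "-1"] 0 by simp
  then show ?case
    using 0 subspace_scale[OF grade_subspace]
    by (intro bexI[of _ "scl V (1 / l) w"]) (auto simp: Vir_scl grade_closed Vir_zero)
next
  case (Suc h)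
  have L1w: "L1 w \<in> grade V (int h)" using Vir_grade[OF Suc.prems(2), of 1] by simp
  obtain x where x: "x \<in> grade V (int h)" "scl V (l + 2 * h) x + T (L1 x) = L1 w"
    using Suc.IH[of "l + 2 * h", OF _ L1w] Suc.prems(1) by auto
  note c = grade_closed[OF x(1)] grade_closed[OF Suc.prems(2)]
  define z where "z = scl V (1 / l) (w - T x)"
  have z: "z \<in> grade V (int (Suc h))"
    unfolding z_def using Vir_grade[OF x(1), of "-1"] Suc.prems(2)
    by (intro subspace_scale[OF grade_subspace] subspace_diff[OF grade_subspace]) (auto simp: add.commute)
  have "L1 w - L1 (T x) = scl V l x"
    using L1_T[OF x(1)] unfolding x(2)[symmetric] by (simp add: scale_left_distrib)
  then have "L1 z = x"
    using Suc.prems(1) c by (simp add: z_def Vir_scl Vir_diff Vir_closed closed)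
  then have "scl V l z + T (L1 z) = w" using Suc.prems(1) by (simp add: z_def)
  with z show ?case by blast
qed

text \<open>Modulo \<open>TV\<close>, which does not contribute to zero modes, every homogeneous vector of positive
  degree is quasi-primary.\<close>

lemma quasi_primary_zero_mode:
  assumes a: "a \<in> grade V n" and n: "n \<ge> 1"
  shows "\<exists>q\<in>grade V n. L1 q = 0 \<and> (\<forall>v\<in>carrier V. nprod V a 0 v = nprod V q 0 v)"
proof (cases "n = 1")
  case True
  then show ?thesis using a L1_grade_one by auto
next
  case False
  define h where "h = nat (n - 1)"
  have h: "n = int h + 1" "h > 0" using n False by (auto simp: h_def)
  have "L1 a \<in> grade V (int h)" using Vir_grade[OF a, of 1] h by simp
  then obtain z where z: "z \<in> grade V (int h)" "scl V (2 * real h) z + T (L1 z) = L1 a"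
    using shifted_T_L1_surj[of "2 * real h"] h(2) by auto
  have Tz: "T z \<in> grade V n" using Vir_grade[OF z(1), of "-1"] h by simp
  have "L1 (a - T z) = 0"
    using L1_T[OF z(1)] z(2) a Tz by (simp add: Vir_diff grade_closed add.commute)
  moreover have "nprod V a 0 v = nprod V (a - T z) 0 v" if "v \<in> carrier V" for v
    using that a z(1) Tz by (simp add: nprod_diff_left grade_closed nprod_T)
  moreover have "a - T z \<in> grade V n" using a Tz subspace_diff[OF grade_subspace] by blast
  ultimately show ?thesis by blast
qed

section \<open>Locally nilpotent zero modes\<close>

text \<open>The divided power \<open>L(1)\<^sup>k / k!\<close> and the exponential \<open>e\<^bsup>L(1)\<^esup>\<close>, a finite sum on homogeneous
  vectors because \<open>L(1)\<close> lowers the degree.\<close>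

definition L1_div :: "nat \<Rightarrow> 'v \<Rightarrow> 'v"
  where "L1_div k v = scl V (1 / fact k) ((L1 ^^ k) v)"

definition exp_L1 :: "'v \<Rightarrow> 'v"
  where "exp_L1 v = Sum_any (\<lambda>k. L1_div k v)"

lemma L1_pow_grade: "v \<in> grade V m \<Longrightarrow> (L1 ^^ k) v \<in> grade V (m - int k)"
proof (induction k)
  case (Suc k)
  then show ?case using Vir_grade[of "(L1 ^^ k) v" "m - int k" 1] by (simp add: algebra_simps)
qed simp

lemma L1_div_closed: "v \<in> carrier V \<Longrightarrow> L1_div k v \<in> carrier V"
proof -
  assume "v \<in> carrier V"
  then have "(L1 ^^ k) v \<in> carrier V" by (induction k) (auto simp: Vir_closed)
  then show ?thesis by (simp add: L1_div_def closed)
qed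

lemma L1_div_grade: "v \<in> grade V m \<Longrightarrow> L1_div k v \<in> grade V (m - int k)"
  unfolding L1_div_def by (intro subspace_scale[OF grade_subspace] L1_pow_grade)

lemma L1_div_0: "L1_div 0 v = v"
  by (simp add: L1_div_def)

lemma L1_L1_div:
  assumes "v \<in> carrier V"
  shows "L1 (L1_div k v) = scl V (real (Suc k)) (L1_div (Suc k) v)"
proof -
  have "(L1 ^^ k) v \<in> carrier V" using assms by (induction k) (auto simp: Vir_closed)
  then show ?thesis by (simp add: L1_div_def Vir_scl field_simps del: of_nat_Suc)
qed

lemma exp_L1_eq_sum:
  assumes v: "v \<in> grade V m" and M: "nat m \<le> M"
  shows "exp_L1 v = (\<Sum>k\<le>M. L1_div k v)"
  unfolding exp_L1_def
proof (rule Sum_any.expand_superset)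
  have "L1_div k v = 0" if "k > M" for k
    using L1_div_grade[OF v, of k] grade_neg[of "m - int k"] that M by auto
  then show "{k. L1_div k v \<noteq> 0} \<subseteq> {..M}" by (auto simp: not_less[symmetric])
qed simp

lemma exp_L1_closed: "v \<in> grade V m \<Longrightarrow> exp_L1 v \<in> carrier V"
  by (simp add: exp_L1_eq_sum[OF _ order_refl] sum_closed L1_div_closed grade_closed)

lemma exp_L1_zero: "exp_L1 0 = 0"
  using exp_L1_eq_sum[OF zero_grade, of 0 0] by (simp add: L1_div_0)

lemma exp_L1_eq_zero:
  assumes v: "v \<in> grade V m" and "exp_L1 v = 0"
  shows "v = 0"
proof -
  have "0 = pr V m (exp_L1 v)" using assms by (simp add: pr_zero)
  also have "\<dots> = (\<Sum>k\<le>nat m. pr V m (L1_div k v))"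
    by (simp add: exp_L1_eq_sum[OF v order_refl] pr_sum L1_div_closed grade_closed[OF v])
  also have "\<dots> = (\<Sum>k\<le>nat m. if k = 0 then v else 0)"
    by (intro sum.cong refl) (simp add: pr_homogeneous[OF L1_div_grade[OF v]] L1_div_0)
  finally show ?thesis by simp
qed

lemma L1_div_quasi_primary_mode:
  assumes q: "q \<in> grade V n" "L1 q = 0" and N: "2 * n - 2 = int N" and u: "u \<in> carrier V"
  shows "L1_div k (nprod V q 0 u)
    = (\<Sum>j\<le>k. scl V (real (N choose j)) (nprod V q (int j) (L1_div (k - j) u)))"
proof (induction k)
  case 0
  then show ?case by (simp add: L1_div_0)
next
  case (Suc k)
  define g where "g j = nprod V q (int j) (L1_div (Suc k - j) u)" for j
  note qc = grade_closed[OF q(1)]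
  note cl = closed L1_div_closed u qc
  have binom: "real (N choose j) * of_int (2 * n - 2 - int j) = real (Suc j) * real (N choose Suc j)" for j
  proof (cases "j \<le> N")
    case True
    then have "(N choose j) * (N - j) = Suc j * (N choose Suc j)"
      using binomial_absorb_comp[of N j] binomial_absorption[of j N] by (simp add: mult.commute)
    then have "real (N choose j) * real (N - j) = real (Suc j) * real (N choose Suc j)"
      by (metis of_nat_mult)
    then show ?thesis using True by (simp add: N)
  qed (simp add: binomial_eq_0)
  have "scl V (real (Suc k)) (L1_div (Suc k) (nprod V q 0 u)) = L1 (L1_div k (nprod V q 0 u))"
    by (simp add: L1_L1_div cl)
  also have "\<dots> = (\<Sum>j\<le>k. scl V (real (N choose j)) (L1 (nprod V q (int j) (L1_div (k - j) u))))"
    unfolding Suc.IH by (subst Vir_sum) (auto simp: cl Vir_scl)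
  also have "\<dots> = (\<Sum>j\<le>k. scl V (real (N choose j) * (real (Suc k) - real j)) (g j)
      + scl V (real (Suc j) * real (N choose Suc j)) (g (Suc j)))"
  proof (intro sum.cong refl)
    fix j assume "j \<in> {..k}"
    then have j: "Suc (k - j) = Suc k - j" "real (Suc k - j) = real (Suc k) - real j" by auto
    have "L1 (nprod V q (int j) (L1_div (k - j) u)) = nprod V q (int j) (L1 (L1_div (k - j) u))
       + scl V (of_int (2 * n - 2 - int j)) (nprod V q (int j + 1) (L1_div (k - j) u))"
      by (rule L1_quasi_primary_mode[OF q]) (simp add: cl)
    also have "L1 (L1_div (k - j) u) = scl V (real (Suc k) - real j) (L1_div (Suc k - j) u)"
      by (simp only: L1_L1_div[OF u] j)
    finally have "L1 (nprod V q (int j) (L1_div (k - j) u)) =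
       scl V (real (Suc k) - real j) (g j) + scl V (of_int (2 * n - 2 - int j)) (g (Suc j))"
      by (simp add: nprod_scl_right cl g_def add.commute del: of_int_diff)
    then show "scl V (real (N choose j)) (L1 (nprod V q (int j) (L1_div (k - j) u))) =
      scl V (real (N choose j) * (real (Suc k) - real j)) (g j)
      + scl V (real (Suc j) * real (N choose Suc j)) (g (Suc j))"
      by (simp only: scale_right_distrib scale_scale binom)
  qed
  also have "\<dots> = (\<Sum>j\<le>Suc k. scl V (real (N choose j) * (real (Suc k) - real j)) (g j))
     + (\<Sum>j\<le>Suc k. scl V (real j * real (N choose j)) (g j))"
    by (subst (2) sum.atMost_Suc_shift) (simp add: sum.distrib)
  also have "\<dots> = (\<Sum>j\<le>Suc k. scl V (real (Suc k)) (scl V (real (N choose j)) (g j)))"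
    unfolding sum.distrib[symmetric]
    by (intro sum.cong refl)
      (simp only: scale_left_distrib[symmetric] scale_scale, rule arg_cong2[where f = "scl V"],
        auto simp: algebra_simps)
  also have "\<dots> = scl V (real (Suc k)) (\<Sum>j\<le>Suc k. scl V (real (N choose j)) (g j))"
    by (simp only: scale_sum_right)
  finally show ?case unfolding g_def
    by (simp only: scale_cancel_left) simp
qed

text \<open>Conjugation by \<open>e\<^bsup>L(1)\<^esup>\<close> turns \<open>q(0)\<close> into the sum of all modes \<open>q(j)\<close>, \<open>0 \<le> j \<le> 2n - 2\<close>,
  weighted by binomial coefficients.  This sum is symmetric or skew-symmetric.\<close>

definition binomial_mode :: "'v \<Rightarrow> nat \<Rightarrow> 'v \<Rightarrow> 'v"
  where "binomial_mode q N w = (\<Sum>j\<le>N. scl V (real (N choose j)) (nprod V q (int j) w))"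

lemma exp_L1_zero_mode:
  assumes q: "q \<in> grade V n" "L1 q = 0" and N: "2 * n - 2 = int N" and u: "u \<in> grade V m"
  shows "exp_L1 (nprod V q 0 u) = binomial_mode q N (exp_L1 u)"
proof -
  note uc = grade_closed[OF u] and qc = grade_closed[OF q(1)]
  define I where "I = nat m"
  have van: "L1_div i u = 0" if "i > I" for i
    using L1_div_grade[OF u, of i] grade_neg[of "m - int i"] that by (auto simp: I_def)
  define h where "h j i = scl V (real (N choose j)) (nprod V q (int j) (L1_div i u))" for j i
  have "nprod V q 0 u \<in> grade V (n + m - 1)" using grade_nprod[OF q(1) u, of 0] by simp
  moreover have "nat (n + m - 1) \<le> N + I" using N unfolding I_def by linarith
  ultimately have "exp_L1 (nprod V q 0 u) = (\<Sum>k\<le>N + I. \<Sum>j\<le>k. h j (k - j))"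
    by (simp add: exp_L1_eq_sum L1_div_quasi_primary_mode[OF q N uc] h_def)
  also have "\<dots> = (\<Sum>(j, i)\<in>{(j, i). j + i \<le> N + I}. h j i)"
    by (rule sum.triangle_reindex_eq[symmetric])
  also have "\<dots> = (\<Sum>(j, i)\<in>{..N} \<times> {..I}. h j i)"
  proof (rule sum.mono_neutral_right)
    show "finite {(j, i). j + i \<le> N + I}"
      by (rule finite_subset[of _ "{..N + I} \<times> {..N + I}"]) auto
    have "h j i = 0" if "j > N \<or> i > I" for j i
      using that by (auto simp: h_def van binomial_eq_0 nprod_zero_right qc)
    moreover have "fst p > N \<or> snd p > I" if "p \<in> {(j, i). j + i \<le> N + I} - {..N} \<times> {..I}" for p
      using that by (cases p) auto
    ultimately show "\<forall>p\<in>{(j, i). j + i \<le> N + I} - {..N} \<times> {..I}. (case p of (j, i) \<Rightarrow> h j i) = 0"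
      by (auto simp: case_prod_unfold)
  qed auto
  also have "\<dots> = (\<Sum>j\<le>N. \<Sum>i\<le>I. h j i)" by (rule sum.cartesian_product[symmetric])
  also have "\<dots> = binomial_mode q N (exp_L1 u)"
    unfolding binomial_mode_def h_def exp_L1_eq_sum[OF u order_refl] I_def[symmetric]
    by (simp add: nprod_sum_right qc L1_div_closed uc scale_sum_right)
  finally show ?thesis .
qed

lemma binomial_mode_closed:
  "q \<in> grade V n \<Longrightarrow> w \<in> carrier V \<Longrightarrow> binomial_mode q N w \<in> carrier V"
  unfolding binomial_mode_def by (simp add: closed grade_closed)

lemma binomial_mode_symmetric:
  assumes q: "q \<in> grade V n" "L1 q = 0" and N: "2 * n - 2 = int N"
    and u: "u \<in> carrier V" and v: "v \<in> carrier V"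
  shows "B (binomial_mode q N u) v = (-1) powi n * B u (binomial_mode q N v)"
proof -
  note cl = closed u v grade_closed[OF q(1)]
  have "B (binomial_mode q N u) v = (\<Sum>j\<le>N. real (N choose j) * B (nprod V q (int j) u) v)"
    unfolding binomial_mode_def by (subst B_sum) (auto simp: cl B_scl)
  also have "\<dots> = (\<Sum>j\<le>N. (-1) powi n * (real (N choose (N - j)) * B (nprod V q (int (N - j)) v) u))"
  proof (intro sum.cong refl)
    fix j assume "j \<in> {..N}"
    then have "N choose j = N choose (N - j)" "2 * n - 2 - int j = int (N - j)"
      using N by (auto simp: binomial_symmetric[symmetric])
    then show "real (N choose j) * B (nprod V q (int j) u) v
      = (-1) powi n * (real (N choose (N - j)) * B (nprod V q (int (N - j)) v) u)"
      by (simp add: B_adjoint[OF q u v] B_sym cl)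
  qed
  also have "\<dots> = (\<Sum>j\<le>N. (-1) powi n * (real (N choose j) * B (nprod V q (int j) v) u))"
    by (rule sum.reindex_bij_witness[where i = "\<lambda>j. N - j" and j = "\<lambda>j. N - j"]) auto
  also have "\<dots> = (-1) powi n * B (binomial_mode q N v) u"
    unfolding binomial_mode_def by (subst B_sum) (auto simp: cl B_scl sum_distrib_left)
  also have "B (binomial_mode q N v) u = B u (binomial_mode q N v)"
    by (intro B_sym u binomial_mode_closed[OF q(1)] v)
  finally show ?thesis .
qed

lemma nilpotent_symmetric:
  assumes S: "\<And>u. u \<in> carrier V \<Longrightarrow> S u \<in> carrier V"
      "\<And>u v. u \<in> carrier V \<Longrightarrow> v \<in> carrier V \<Longrightarrow> B (S u) v = \<epsilon> * B u (S v)"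
    and "w \<in> carrier V" "(S ^^ k) w = 0"
  shows "S w = 0"
  using assms(3,4)
proof (induction k arbitrary: w)
  case 0
  then have "B (S w) (S w) = 0" using S(2)[of w "S w"] S(1) by (simp add: B_zero)
  then show ?case using eq_zero_if_B_zero S 0 by blast
next
  case (Suc k)
  have "S (S w) = 0" using Suc.IH[of "S w"] Suc.prems S(1) by (simp add: funpow_swap1)
  then have "B (S w) (S w) = 0" using S(2)[of w "S w"] S(1) Suc.prems by (simp add: B_zero)
  then show ?case using eq_zero_if_B_zero S Suc.prems by blast
qed

text \<open>As \<open>q(0)\<close> is nilpotent on \<open>u\<close>, its conjugate is nilpotent on \<open>e\<^bsup>L(1)\<^esup>u\<close>.  Being symmetric up to sign
  for a positive-definite form, the conjugate annihilates that vector.\<close>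

lemma nilpotent_zero_mode:
  assumes q: "q \<in> grade V n" "L1 q = 0" and n: "n \<ge> 1" and u: "u \<in> grade V m"
    and nil: "(nprod V q 0 ^^ k) u = 0"
  shows "nprod V q 0 u = 0"
proof -
  define N where "N = nat (2 * n - 2)"
  have N: "2 * n - 2 = int N" using n by (simp add: N_def)
  have pow: "(nprod V q 0 ^^ i) u \<in> grade V (m + int i * (n - 1))
     \<and> exp_L1 ((nprod V q 0 ^^ i) u) = (binomial_mode q N ^^ i) (exp_L1 u)" for i
  proof (induction i)
    case 0
    then show ?case using u by simp
  next
    case (Suc i)
    then show ?case
      using grade_nprod[OF q(1), of "(nprod V q 0 ^^ i) u" "m + int i * (n - 1)" 0]
        exp_L1_zero_mode[OF q N, of "(nprod V q 0 ^^ i) u" "m + int i * (n - 1)"]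
      by (simp add: algebra_simps)
  qed
  then have "(binomial_mode q N ^^ k) (exp_L1 u) = 0" using nil pow[of k] by (simp add: exp_L1_zero)
  then have "binomial_mode q N (exp_L1 u) = 0"
    using nilpotent_symmetric[of "binomial_mode q N" "(-1) powi n"]
      binomial_mode_closed[OF q(1)] binomial_mode_symmetric[OF q N] exp_L1_closed[OF u] by blast
  then show ?thesis
    using exp_L1_zero_mode[OF q N u] exp_L1_eq_zero[OF grade_nprod[OF q(1) u]] by simp
qed

text \<open>A skew-symmetric operator has no nonzero real eigenvalue.\<close>

lemma diagonalizable_skew_zero_mode:
  assumes q: "q \<in> grade V 1" and v: "v \<in> carrier V"
    and fold: "fold (\<lambda>c u. nprod V q 0 u + scl V (x c) u) cs v = 0"
  shows "nprod V q 0 v = 0"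
  using v fold
proof (induction cs arbitrary: v)
  case Nil
  then show ?case by (simp add: nprod_zero_right grade_closed[OF q])
next
  case (Cons c cs)
  note cl = closed grade_closed[OF q] Cons.prems(1)
  let ?Q = "nprod V q 0"
  have skew: "B (?Q w) w = 0" if "w \<in> carrier V" for w
    using B_adjoint[OF q L1_grade_one[OF q] that that, of 0] B_sym[of w "?Q w"] that by (simp add: cl)
  have eq: "?Q (?Q v) + scl V (x c) (?Q v) = 0"
    using Cons.IH[of "?Q v + scl V (x c) v"] Cons.prems
    by (simp add: cl nprod_add_right nprod_scl_right)
  then have "B (?Q (?Q v) + scl V (x c) (?Q v)) (?Q v) = 0" by (simp add: B_zero cl)
  then have *: "x c * B (?Q v) (?Q v) = 0" using skew[of "?Q v"] by (simp add: cl B_add B_scl)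
  show ?case
  proof (cases "x c = 0")
    case True
    then have "?Q (?Q v) = 0" using eq by simp
    then have "B (?Q v) (?Q v) = 0"
      using B_adjoint[OF q L1_grade_one[OF q] Cons.prems(1), of "?Q v" 0] by (simp add: cl B_zero)
    then show ?thesis by (rule eq_zero_if_B_zero[rotated]) (simp add: cl)
  next
    case False
    then have "B (?Q v) (?Q v) = 0" using * by simp
    then show ?thesis by (rule eq_zero_if_B_zero[rotated]) (simp add: cl)
  qed
qed

end

section \<open>Automorphisms preserve the increasing filtration\<close>

context positive_definite_voa
begin

context
  fixes f :: "'v \<Rightarrow> 'v"
  assumes f: "f \<in> va_auts V"
begin

text \<open>The difference of the conformal vectors \<open>f(\<omega>)\<close> and \<open>\<omega>\<close>.\<close>

definition conf_shift :: 'v where "conf_shift = f (conf V) - conf V"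

lemma conf_shift_closed: "conf_shift \<in> carrier V"
  by (simp add: conf_shift_def closed conf_closed aut_closed f)

lemma conf_shift_zero_mode: "v \<in> carrier V \<Longrightarrow> nprod V (pr V n conf_shift) 0 v = 0"
  using nprod_pr_eq_zero[OF conf_shift_closed] aut_conf_zero_mode[OF f] conf_shift_def by simp

lemma conf_shift_derivative:
  "n \<noteq> 1 \<Longrightarrow> \<exists>y\<in>grade V (n - 1). T (pr V n conf_shift) = - T (T y)"
  by (rule central_zero_mode[OF pr_grade[OF conf_shift_closed] _ conf_shift_zero_mode])

lemma aut_conf_mode_one:
  assumes "v \<in> carrier V"
  shows "nprod V (f (conf V)) 1 v = Vir V 0 v + nprod V conf_shift 1 v"
  using nprod_diff_left[OF aut_closed[OF f conf_closed] conf_closed assms, of 1]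
  by (simp add: conf_shift_def Vir_def)

text \<open>If \<open>N\<close> is the largest degree for which the first mode of a component of \<open>f(\<omega>) - \<omega>\<close>
  acts nontrivially, then this mode is the leading term of \<open>f(\<omega>)(1)\<close> with respect to the
  filtration, to which \<open>L(0)\<close> is added if \<open>N = 2\<close>.\<close>

lemma leading_term:
  assumes N: "N \<ge> 2" "\<And>n v. n > N \<Longrightarrow> v \<in> carrier V \<Longrightarrow> nprod V (pr V n conf_shift) 1 v = 0"
    and w: "w \<in> upto M" and k: "k \<ge> M + N - 2"
  shows "pr V k (nprod V conf_shift 1 w) = nprod V (pr V N conf_shift) 1 (pr V (k - N + 2) w)"
proof -
  define S where "S = insert N {n. pr V n conf_shift \<noteq> 0}"
  have S: "finite S" using finite_support[OF conf_shift_closed] by (simp add: S_def)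
  note cl = upto_closed[OF w] pr_closed conf_shift_closed
  have "pr V k (nprod V conf_shift 1 w) = (\<Sum>n\<in>S. nprod V (pr V n conf_shift) 1 (pr V (k - n + 1 + 1) w))"
    using S by (intro pr_nprod cl) (auto simp: S_def)
  also have "\<dots> = (\<Sum>n\<in>S. if n = N then nprod V (pr V N conf_shift) 1 (pr V (k - N + 2) w) else 0)"
  proof (intro sum.cong refl)
    fix n
    show "nprod V (pr V n conf_shift) 1 (pr V (k - n + 1 + 1) w)
      = (if n = N then nprod V (pr V N conf_shift) 1 (pr V (k - N + 2) w) else 0)"
    proof (cases n N rule: linorder_cases)
      case less
      then have "pr V (k - n + 1 + 1) w = 0" using w k by (simp add: upto_def)
      then show ?thesis using less by (simp add: nprod_zero_right cl)
    next
      case greater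
      then show ?thesis using N(2)[OF greater pr_closed] by (simp add: cl)
    next
      case equal
      then have "k - n + 1 + 1 = k - N + 2" by simp
      then show ?thesis using equal by (simp only: if_True refl simp_thms)
    qed
  qed
  also have "\<dots> = nprod V (pr V N conf_shift) 1 (pr V (k - N + 2) w)" using S by (simp add: S_def)
  finally show ?thesis .
qed

lemma leading_term_fold:
  assumes N: "N \<ge> 2" "\<And>n v. n > N \<Longrightarrow> v \<in> carrier V \<Longrightarrow> nprod V (pr V n conf_shift) 1 v = 0"
    and w: "w \<in> upto M"
  defines "X \<equiv> (\<lambda>c u. nprod V (f (conf V)) 1 u - scl V (of_int c) u)"
  defines "R \<equiv> (\<lambda>c u. nprod V (pr V N conf_shift) 1 u
    + scl V (if N = 2 then of_int (M - c) else 0) u)"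
  shows "pr V (M + int (length cs) * (N - 2)) (fold X cs w) = fold R cs (pr V M w)"
proof -
  define M' where "M' = M"
  have R: "R = (\<lambda>c u. nprod V (pr V N conf_shift) 1 u
    + scl V (if N = 2 then of_int (M' - c) else 0) u)" unfolding R_def M'_def ..
  have "N = 2 \<Longrightarrow> M' = M" by (simp add: M'_def)
  then show ?thesis using w
  proof (induction cs arbitrary: w M)
    case Nil
    then show ?case by simp
  next
    case (Cons c cs)
    note wc = upto_closed[OF Cons.prems(2)]
    note cl = wc pr_closed closed Vir_closed conf_shift_closed
    have Xw: "X c w = Vir V 0 w + nprod V conf_shift 1 w - scl V (of_int c) w"
      by (simp add: X_def aut_conf_mode_one wc)
    have pr: "pr V k (X c w) = nprod V (pr V N conf_shift) 1 (pr V (k - N + 2) w) + scl V (of_int (k - c)) (pr V k w)"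
      if "k \<ge> M + N - 2" for k
      unfolding Xw using leading_term[OF N Cons.prems(2) that]
      by (simp add: pr_diff pr_add pr_scl pr_L0 cl scale_left_diff_distrib)
    have "X c w \<in> upto (M + (N - 2))"
      unfolding upto_def
    proof (intro CollectI conjI allI impI)
      show "X c w \<in> carrier V" unfolding Xw by (simp add: cl)
      fix k assume k: "k > M + (N - 2)"
      then have "pr V (k - N + 2) w = 0" "pr V k w = 0" using Cons.prems(2) N(1) by (auto simp: upto_def)
      then show "pr V k (X c w) = 0" using pr[of k] k by (simp add: nprod_zero_right cl)
    qed
    moreover have "pr V (M + (N - 2)) (X c w) = R c (pr V M w)"
    proof (cases "N = 2")
      case True
      then show ?thesis using pr[of M] Cons.prems(1) by (simp add: R)
    next
      case False
      then have "pr V (M + (N - 2)) w = 0" using Cons.prems(2) N(1) by (simp add: upto_def)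
      then show ?thesis using pr[of "M + (N - 2)"] False by (simp add: R)
    qed
    ultimately show ?case
      using Cons.IH[of "M + (N - 2)" "X c w"] Cons.prems(1) by (simp add: algebra_simps)
  qed
qed

text \<open>Since \<open>f(\<omega>)(1)\<close> is diagonalizable, its leading term is locally nilpotent if it raises
  degrees, and diagonalizable if it preserves them.  As it is the zero mode of a quasi-primary
  vector, positivity makes it vanish in either case.\<close>

lemma conf_shift_mode_one:
  assumes "n \<ge> 2" "v \<in> carrier V"
  shows "nprod V (pr V n conf_shift) 1 v = 0"
proof (rule ccontr)
  assume nz: "nprod V (pr V n conf_shift) 1 v \<noteq> 0"
  define S where "S = {n. n \<ge> 2 \<and> (\<exists>v\<in>carrier V. nprod V (pr V n conf_shift) 1 v \<noteq> 0)}"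
  have "S \<subseteq> {n. pr V n conf_shift \<noteq> 0}" by (auto simp: S_def nprod_zero_left)
  then have fin: "finite S" using finite_subset finite_support[OF conf_shift_closed] by blast
  have "n \<in> S" using nz assms by (auto simp: S_def)
  define N where "N = Max S"
  have "N \<in> S" unfolding N_def using fin \<open>n \<in> S\<close> by (intro Max_in) auto
  have top: "nprod V (pr V n conf_shift) 1 v = 0" if "n > N" "v \<in> carrier V" for n v
  proof -
    have "n \<notin> S" using Max_ge[OF fin, of n] that(1) unfolding N_def by linarith
    moreover have "n \<ge> 2" using \<open>N \<in> S\<close> that(1) by (simp add: S_def)
    ultimately show ?thesis using that(2) by (auto simp: S_def)
  qed
  have N2: "N \<ge> 2" using \<open>N \<in> S\<close> by (simp add: S_def)
  obtain y where y: "y \<in> grade V (N - 1)" "T (pr V N conf_shift) = - T (T y)"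
    using conf_shift_derivative[of N] N2 by auto
  obtain q where q: "q \<in> grade V (N - 1)" "L1 q = 0" "\<And>v. v \<in> carrier V \<Longrightarrow> nprod V y 0 v = nprod V q 0 v"
    using quasi_primary_zero_mode[OF y(1)] N2 by auto
  note qc = grade_closed[OF q(1)]
  have mode: "nprod V (pr V N conf_shift) 1 v = nprod V q 0 v" if "v \<in> carrier V" for v
    using modes_of_T_eq(1)[OF pr_closed[OF conf_shift_closed] grade_closed[OF y(1)] y(2) that] q(3) that by simp
  have homogeneous: "nprod V q 0 u = 0" if u: "u \<in> grade V m" for u m
  proof -
    note uc = grade_closed[OF u]
    define R where "R c u = nprod V (pr V N conf_shift) 1 u
      + scl V (if N = 2 then of_int (m - c) else 0) u" for c u
    define Q where "Q c u = nprod V q 0 u + scl V (if N = 2 then of_int (m - c) else 0) u" for c u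
    obtain cs where "fold (\<lambda>c u. nprod V (f (conf V)) 1 u - scl V (of_int c) u) cs u = 0"
      using fold_aut_conf[OF f uc] by blast
    then have "fold R cs u = 0"
      using leading_term_fold[OF N2 top grade_subset_upto[OF order_refl u], of cs]
      by (simp add: pr_homogeneous[OF u] pr_zero R_def[abs_def])
    moreover have "fold R cs w = fold Q cs w" if "w \<in> carrier V" for w
      using that
    proof (induction cs arbitrary: w)
      case (Cons c cs)
      have "R c w = Q c w" "Q c w \<in> carrier V" using Cons.prems by (auto simp: R_def Q_def mode closed qc)
      then show ?case using Cons.IH[of "Q c w"] by simp
    qed simp
    ultimately have fold: "fold Q cs u = 0" using uc by simp
    show ?thesis
    proof (cases "N = 2")
      case True
      have "fold (\<lambda>c u. nprod V q 0 u + scl V (of_int (m - c)) u) cs u = 0"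
        using fold True by (simp add: Q_def[abs_def])
      moreover have "q \<in> grade V 1" using q(1) True by simp
      ultimately show ?thesis
        using diagonalizable_skew_zero_mode[OF _ uc, of q "\<lambda>c. of_int (m - c)" cs] by simp
    next
      case False
      have "fold Q cs w = (nprod V q 0 ^^ length cs) w" for w
        using False by (induction cs arbitrary: w) (auto simp: Q_def funpow_swap1)
      then show ?thesis using nilpotent_zero_mode[OF q(1,2) _ u, of "length cs"] N2 fold by simp
    qed
  qed
  obtain v where v: "v \<in> carrier V" "nprod V (pr V N conf_shift) 1 v \<noteq> 0"
    using \<open>N \<in> S\<close> by (auto simp: S_def)
  have "nprod V q 0 v = (\<Sum>l | pr V l v \<noteq> 0. nprod V q 0 (pr V l v))"
    using sum_pr[OF v(1) finite_support[OF v(1)]] v(1) qc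
    by (subst nprod_sum_right[symmetric]) (auto simp: pr_closed)
  also have "\<dots> = 0" by (intro sum.neutral ballI homogeneous[OF pr_grade[OF v(1)]])
  finally show False using v mode by simp
qed

text \<open>Only the component of degree one contributes to the difference of \<open>f(\<omega>)(1)\<close> and \<open>L(0)\<close>, and it
  lowers degrees.\<close>

lemma aut_conf_mode_one_eq:
  assumes v: "v \<in> carrier V"
  shows "nprod V (f (conf V)) 1 v = Vir V 0 v + nprod V (pr V 1 conf_shift) 1 v"
proof -
  define S where "S = insert 1 {n. pr V n conf_shift \<noteq> 0}"
  have S: "finite S" using finite_support[OF conf_shift_closed] by (simp add: S_def)
  have zero: "nprod V (pr V n conf_shift) 1 v = 0" if "n \<noteq> 1" for n
  proof -
    have "n < 0 \<or> n = 0 \<or> n \<ge> 2" using that by arith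
    then consider "n < 0" | "n = 0" | "n \<ge> 2" by blast
    then show ?thesis
    proof cases
      case 1
      then show ?thesis
        using pr_grade[OF conf_shift_closed, of n] grade_neg v by (simp add: nprod_zero_left)
    next
      case 2
      then obtain k where "pr V n conf_shift = scl V k (vac V)"
        using grade_zero pr_grade[OF conf_shift_closed] by blast
      then show ?thesis by (simp add: nprod_scl_left vac_closed vac_nprod v)
    qed (simp add: conf_shift_mode_one v)
  qed
  have "nprod V conf_shift 1 v = nprod V (\<Sum>n\<in>S. pr V n conf_shift) 1 v"
    using sum_pr[OF conf_shift_closed S] by (simp add: S_def subset_insertI)
  also have "\<dots> = (\<Sum>n\<in>S. nprod V (pr V n conf_shift) 1 v)"
    by (intro nprod_sum_left v pr_closed conf_shift_closed)
  also have "\<dots> = (\<Sum>n\<in>S. if n = 1 then nprod V (pr V 1 conf_shift) 1 v else 0)"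
    using zero by (intro sum.cong) auto
  also have "\<dots> = nprod V (pr V 1 conf_shift) 1 v" using S by (simp add: S_def)
  finally show ?thesis using aut_conf_mode_one[OF v] by simp
qed

lemma aut_grade_upto:
  assumes v: "v \<in> grade V m"
  shows "f v \<in> upto m"
proof -
  note fv = aut_closed[OF f grade_closed[OF v]]
  have eig: "Vir V 0 (f v) + nprod V (pr V 1 conf_shift) 1 (f v) = scl V (of_int m) (f v)"
    using aut_conf_eigenvector[OF f v] aut_conf_mode_one_eq[OF fv] by simp
  show ?thesis
  proof (rule ccontr)
    assume "f v \<notin> upto m"
    define S where "S = {n. n > m \<and> pr V n (f v) \<noteq> 0}"
    have S: "finite S" "S \<noteq> {}"
      using finite_support[OF fv] \<open>f v \<notin> upto m\<close> fv by (auto simp: S_def upto_def)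
    define n where "n = Max S"
    have n: "n > m" "pr V n (f v) \<noteq> 0" using Max_in[OF S] by (auto simp: n_def S_def)
    have "n + 1 \<notin> S" using Max_ge[OF S(1), of "n + 1"] unfolding n_def by linarith
    then have "pr V (n + 1) (f v) = 0" using n by (simp add: S_def)
    then have "pr V n (nprod V (pr V 1 conf_shift) 1 (f v)) = 0"
      using pr_nprod_homogeneous_left[OF pr_grade[OF conf_shift_closed] fv, of n 1 1]
      by (simp add: nprod_zero_right pr_closed conf_shift_closed)
    then have "scl V (of_int n) (pr V n (f v)) = scl V (of_int m) (pr V n (f v))"
      using arg_cong[OF eig, of "pr V n"] fv
      by (simp add: pr_add pr_L0 pr_scl closed Vir_closed pr_closed conf_shift_closed)
    then show False using n by simp
  qed
qed

lemma aut_upto: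
  assumes v: "v \<in> upto m"
  shows "f v \<in> upto m"
proof -
  note vc = upto_closed[OF v]
  have "f v = (\<Sum>n | pr V n v \<noteq> 0. f (pr V n v))"
    using sum_pr[OF vc finite_support[OF vc]] vc
    by (subst aut_sum[OF f, symmetric]) (auto simp: pr_closed)
  also have "\<dots> \<in> upto m"
  proof (intro subspace_sum[OF subspace_upto])
    fix n assume "n \<in> {n. pr V n v \<noteq> 0}"
    then have "n \<le> m" using v by (force simp: upto_def)
    then show "f (pr V n v) \<in> upto m" using upto_mono[OF _ aut_grade_upto[OF pr_grade[OF vc]]] by blast
  qed
  finally show ?thesis .
qed

end

section \<open>The associated graded automorphism\<close>

text \<open>The map induced by \<open>f\<close> on the associated graded space of the filtration, which is
  identified with \<open>V\<close> itself by means of the grading.\<close>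

definition gr :: "('v \<Rightarrow> 'v) \<Rightarrow> 'v \<Rightarrow> 'v"
  where "gr f = restrict (\<lambda>v. Sum_any (\<lambda>m. pr V m (f (pr V m v)))) (carrier V)"

lemma gr_decomp:
  assumes f: "f \<in> va_auts V" and v: "v \<in> carrier V"
  shows gr_closed: "gr f v \<in> carrier V" and pr_gr: "pr V n (gr f v) = pr V n (f (pr V n v))"
proof -
  define S where "S = insert n {n. pr V n v \<noteq> 0}"
  have S: "finite S" using finite_support[OF v] by (simp add: S_def)
  have cl: "f (pr V m v) \<in> carrier V" for m using aut_closed[OF f] pr_closed[OF v] by simp
  have eq: "gr f v = (\<Sum>m\<in>S. pr V m (f (pr V m v)))"
    unfolding gr_def using v S
    by (simp, intro Sum_any.expand_superset) (auto simp: S_def aut_zero[OF f] pr_zero)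
  show "gr f v \<in> carrier V" unfolding eq by (intro sum_closed pr_closed cl)
  show "pr V n (gr f v) = pr V n (f (pr V n v))"
    unfolding eq by (subst pr_sum_homogeneous) (auto simp: S intro!: pr_grade cl, simp add: S_def)
qed

lemma gr_grade: "f \<in> va_auts V \<Longrightarrow> v \<in> grade V n \<Longrightarrow> gr f v = pr V n (f v)"
  by (rule eq_if_pr_eq)
    (auto simp: gr_decomp pr_closed aut_closed grade_closed pr_homogeneous
      pr_homogeneous[OF pr_grade] aut_zero pr_zero)

lemma gr_compose:
  assumes f: "f \<in> va_auts V" and g: "g \<in> va_auts V" and v: "v \<in> carrier V"
  shows "gr (compose (carrier V) f g) v = gr f (gr g v)"
proof (rule eq_if_pr_eq)
  note fg = compose_aut[OF f g]
  show "gr (compose (carrier V) f g) v \<in> carrier V" "gr f (gr g v) \<in> carrier V"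
    by (auto intro!: gr_closed fg f g v)
  fix n
  \<comment> \<open>\<open>f\<close> maps \<open>x\<close> and its leading component to vectors with the same component of degree \<open>n\<close>.\<close>
  define x where "x = g (pr V n v)"
  have x: "x \<in> upto n" unfolding x_def by (intro aut_grade_upto g pr_grade v)
  note xc = upto_closed[OF x]
  have "x - pr V n x \<in> upto (n - 1)"
    unfolding upto_def
  proof (intro CollectI conjI allI impI)
    show "x - pr V n x \<in> carrier V" by (intro closed xc pr_closed)
    fix k assume k: "k > n - 1"
    have "pr V k (x - pr V n x) = pr V k x - (if k = n then pr V n x else 0)"
      by (simp add: pr_diff xc pr_closed pr_homogeneous[OF pr_grade[OF xc]])
    then show "pr V k (x - pr V n x) = 0" using x k by (auto simp: upto_def)
  qed
  then have "f (x - pr V n x) \<in> upto (n - 1)" by (rule aut_upto[OF f])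
  then have "pr V n (f x - f (pr V n x)) = 0"
    using xc by (simp add: aut_diff[OF f] pr_closed upto_def)
  then have "pr V n (f x) = pr V n (f (pr V n x))"
    using xc by (simp add: pr_diff aut_closed[OF f] pr_closed)
  then show "pr V n (gr (compose (carrier V) f g) v) = pr V n (gr f (gr g v))"
    using f g v by (simp add: pr_gr[OF fg] pr_gr gr_closed compose_eq pr_closed x_def)
qed

lemma gr_id: "v \<in> carrier V \<Longrightarrow> gr (restrict id (carrier V)) v = v"
  by (rule eq_if_pr_eq) (auto simp: gr_decomp id_aut pr_closed pr_homogeneous[OF pr_grade])

lemma gr_aut:
  assumes f: "f \<in> va_auts V"
  shows "gr f \<in> va_auts V"
proof -
  have add: "gr f (u + v) = gr f u + gr f v" if "u \<in> carrier V" "v \<in> carrier V" for u v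
    by (rule eq_if_pr_eq) (use that in \<open>simp_all add: gr_decomp[OF f] closed pr_add pr_closed aut_closed[OF f] aut_add[OF f]\<close>)
  have scl: "gr f (scl V k v) = scl V k (gr f v)" if "v \<in> carrier V" for k v
    by (rule eq_if_pr_eq) (use that in \<open>simp_all add: gr_decomp[OF f] closed pr_scl pr_closed aut_closed[OF f] aut_scl[OF f]\<close>)
  have nprod: "gr f (nprod V a n b) = nprod V (gr f a) n (gr f b)"
    if a: "a \<in> carrier V" and b: "b \<in> carrier V" for a b n
  proof (rule eq_if_pr_eq)
    note cl = closed pr_closed a b aut_closed[OF f] gr_closed[OF f]
    show "gr f (nprod V a n b) \<in> carrier V" "nprod V (gr f a) n (gr f b) \<in> carrier V"
      by (simp_all add: cl)
    fix k
    define S where "S = {n. pr V n a \<noteq> 0}"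
    have S: "finite S" using finite_support[OF a] by (simp add: S_def)
    have "pr V k (gr f (nprod V a n b)) = pr V k (f (\<Sum>j\<in>S. nprod V (pr V j a) n (pr V (k - j + n + 1) b)))"
      using pr_nprod[OF a b S] by (simp add: pr_gr[OF f] cl S_def)
    also have "\<dots> = (\<Sum>j\<in>S. pr V k (nprod V (f (pr V j a)) n (f (pr V (k - j + n + 1) b))))"
      by (simp add: aut_sum[OF f] pr_sum cl aut_nprod[OF f])
    also have "\<dots> = (\<Sum>j\<in>S. nprod V (pr V j (gr f a)) n (pr V (k - j + n + 1) (gr f b)))"
    proof (intro sum.cong refl)
      fix j
      have "pr V (j + (k - j + n + 1) - n - 1) (nprod V (f (pr V j a)) n (f (pr V (k - j + n + 1) b)))
        = nprod V (pr V j (f (pr V j a))) n (pr V (k - j + n + 1) (f (pr V (k - j + n + 1) b)))"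
        by (intro pr_nprod_upto aut_grade_upto f pr_grade a b)
      then show "pr V k (nprod V (f (pr V j a)) n (f (pr V (k - j + n + 1) b)))
        = nprod V (pr V j (gr f a)) n (pr V (k - j + n + 1) (gr f b))"
        by (simp add: pr_gr[OF f] a b)
    qed
    also have "\<dots> = pr V k (nprod V (gr f a) n (gr f b))"
    proof (rule pr_nprod[symmetric])
      show "{n. pr V n (gr f a) \<noteq> 0} \<subseteq> S"
        by (auto simp: S_def pr_gr[OF f a] aut_zero[OF f] pr_zero)
    qed (simp_all add: cl S)
    finally show "pr V k (gr f (nprod V a n b)) = pr V k (nprod V (gr f a) n (gr f b))" .
  qed
  have vac: "gr f (vac V) = vac V"
    using gr_grade[OF f vac_grade] by (simp add: aut_vac[OF f] pr_homogeneous[OF vac_grade])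
  obtain g where g: "g \<in> va_auts V"
    "\<And>v. v \<in> carrier V \<Longrightarrow> g (f v) = v" "\<And>v. v \<in> carrier V \<Longrightarrow> f (g v) = v"
    using inverse_aut[OF f] by metis
  have "compose (carrier V) g f = restrict id (carrier V)" "compose (carrier V) f g = restrict id (carrier V)"
    using g by (auto simp: compose_def)
  then have "gr g (gr f v) = v" "gr f (gr g v) = v" if "v \<in> carrier V" for v
    using gr_compose[OF g(1) f that] gr_compose[OF f g(1) that] gr_id[OF that] by simp_all
  then have "bij_betw (gr f) (carrier V) (carrier V)"
    using gr_closed[OF f] gr_closed[OF g(1)] by (intro bij_betw_byWitness[of _ "gr g"]) auto
  then have "gr f \<in> Bij (carrier V)" by (simp add: Bij_def gr_def)
  then show ?thesis using add scl nprod vac by (simp add: va_auts_def)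
qed

text \<open>The degree-two part of \<open>f(\<omega>) - \<omega>\<close> is detected by its second mode on \<open>V\<^sub>1\<close>, which vanishes
  because \<open>L(1)\<close> annihilates \<open>V\<^sub>1\<close>.\<close>

lemma gr_conf:
  assumes f: "f \<in> va_auts V"
  shows "gr f (conf V) = conf V"
proof -
  let ?a = "pr V 2 (conf_shift f)"
  note sc = conf_shift_closed[OF f]
  note ac = pr_closed[OF sc, of 2]
  note g = gr_aut[OF f]
  have "gr f (conf V) = pr V 2 (conf V + conf_shift f)"
    by (simp add: gr_grade[OF f conf_grade] conf_shift_def[OF f])
  then have grc: "gr f (conf V) = conf V + ?a"
    by (simp add: pr_add conf_closed sc pr_homogeneous[OF conf_grade])
  obtain y where y: "y \<in> grade V 1" "T ?a = - T (T y)"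
    using conf_shift_derivative[OF f, of 2] by auto
  note yc = grade_closed[OF y(1)]
  obtain h where h: "h \<in> va_auts V" "\<And>v. v \<in> carrier V \<Longrightarrow> f (h v) = v"
    using inverse_aut[OF f] by metis
  define x where "x = gr h y"
  have x: "x \<in> grade V 1"
    unfolding x_def by (simp add: gr_grade[OF h(1) y(1)] pr_grade aut_closed[OF h(1)] yc)
  have "compose (carrier V) f h = restrict id (carrier V)" using h(2) by (auto simp: compose_def)
  then have gx: "gr f x = y" unfolding x_def using gr_compose[OF f h(1) yc] gr_id[OF yc] by simp
  have "0 = gr f (L1 x)" using L1_grade_one[OF x] by (simp add: aut_zero[OF g])
  also have "\<dots> = nprod V (conf V + ?a) 2 y"
    using grc gx by (simp add: Vir_def aut_nprod[OF g] conf_closed grade_closed[OF x])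
  also have "\<dots> = nprod V ?a 2 y"
    using L1_grade_one[OF y(1)] by (simp add: nprod_add_left conf_closed ac yc Vir_def)
  also have "\<dots> = scl V 2 (nprod V y 1 y)"
    by (rule modes_of_T_eq(2)[OF ac yc y(2) yc])
  finally have "nprod V y 1 y = 0" by simp
  then have "B y y = 0"
    using B_adjoint[OF y(1) L1_grade_one[OF y(1)] vac_closed yc, of "-1"]
    by (simp add: vac_right yc B_zero vac_closed)
  then have "y = 0" using eq_zero_if_B_zero yc by blast
  then have Ta: "T ?a = 0" using y(2) by (simp add: Vir_zero)
  have "nprod V ?a n (conf V) = 0" if "n \<ge> 0" for n
    using nprod_T[OF ac conf_closed, of "n + 1"] that by (simp add: Ta nprod_zero_left conf_closed)
  then have "Vir V 0 ?a = 0"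
    using skew_symmetry[OF ac conf_closed, of 1 0] by (simp add: Vir_def)
  then have "?a = 0" using L0_grade[OF pr_grade[OF sc], of 2] by simp
  then show ?thesis using grc by simp
qed

lemma gr_conf_aut: "f \<in> va_auts V \<Longrightarrow> gr f \<in> conf_auts V"
  by (simp add: conf_auts_def gr_aut gr_conf)

lemma gr_eq_self:
  assumes f: "f \<in> va_auts V" and grade: "\<And>n v. v \<in> grade V n \<Longrightarrow> f v \<in> grade V n"
  shows "gr f = f"
proof (rule aut_eqI[OF gr_aut[OF f] f])
  fix v assume v: "v \<in> carrier V"
  have fp: "f (pr V n v) \<in> grade V n" for n by (intro grade pr_grade v)
  have "f v = (\<Sum>n | pr V n v \<noteq> 0. f (pr V n v))"
    using sum_pr[OF v finite_support[OF v]] v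
    by (subst aut_sum[OF f, symmetric]) (auto simp: pr_closed)
  then have "pr V n (f v) = (if pr V n v \<noteq> 0 then f (pr V n v) else 0)" for n
    using pr_sum_homogeneous[OF finite_support[OF v], of "\<lambda>n. f (pr V n v)"] fp by simp
  then have eq: "pr V n (f v) = f (pr V n v)" for n using aut_zero[OF f] by (metis (full_types))
  show "gr f v = f v"
    by (rule eq_if_pr_eq[OF gr_closed[OF f v] aut_closed[OF f v]])
      (simp add: eq pr_gr[OF f v] pr_homogeneous[OF fp])
qed

lemma gr_conf_auts:
  assumes "f \<in> conf_auts V"
  shows "gr f = f"
proof -
  have f: "f \<in> va_auts V" "f (conf V) = conf V" using assms by (auto simp: conf_auts_def)
  have "f v \<in> grade V n" if v: "v \<in> grade V n" for n v
  proof (rule grade_if_L0_eigenvector)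
    show "f v \<in> carrier V" by (rule aut_closed[OF f(1) grade_closed[OF v]])
    show "Vir V 0 (f v) = scl V (of_int n) (f v)"
      using aut_conf_eigenvector[OF f(1) v] unfolding f(2) by (simp add: Vir_def)
  qed
  then show ?thesis by (rule gr_eq_self[OF f(1)])
qed

lemma minus_auts_eq_kernel: "minus_auts V = {f \<in> va_auts V. gr f = restrict id (carrier V)}"
proof -
  have "f \<in> minus_auts V \<longleftrightarrow> gr f = restrict id (carrier V)" if f: "f \<in> va_auts V" for f
  proof
    assume "f \<in> minus_auts V"
    then have pr: "pr V n (f v) = v" if "v \<in> grade V n" for n v
      using that by (simp add: minus_auts_def)
    show "gr f = restrict id (carrier V)"
    proof (rule aut_eqI[OF gr_aut[OF f] id_aut])
      fix v assume v: "v \<in> carrier V"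
      have "gr f v = v"
        by (rule eq_if_pr_eq[OF gr_closed[OF f v] v]) (simp add: pr_gr[OF f v] pr[OF pr_grade[OF v]])
      then show "gr f v = restrict id (carrier V) v" using v by simp
    qed
  next
    assume gr: "gr f = restrict id (carrier V)"
    have "pr V n (f v) = v" if "v \<in> grade V n" for n v
      using gr_grade[OF f that] gr grade_closed[OF that] by simp
    moreover have "f ` grade V n \<subseteq> span (\<Union>k\<in>{..n}. grade V k)" for n
      using aut_grade_upto[OF f] by (auto simp: upto_eq_span)
    ultimately show "f \<in> minus_auts V" using f by (simp add: minus_auts_def)
  qed
  then show ?thesis by (auto simp: minus_auts_def)
qed

lemma conf_auts_eq_va_auts:
  assumes "J1 V = {0}"
  shows "conf_auts V = va_auts V"
proof -
  have "f \<in> conf_auts V" if f: "f \<in> va_auts V" for f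
  proof -
    have "pr V 1 (conf_shift f) \<in> J1 V"
      using pr_grade[OF conf_shift_closed[OF f]] conf_shift_zero_mode[OF f] by (simp add: J1_def)
    then have "pr V 1 (conf_shift f) = 0" using assms by simp
    then have "nprod V (f (conf V)) 1 v = Vir V 0 v" if "v \<in> carrier V" for v
      using aut_conf_mode_one_eq[OF f that] that by (simp add: nprod_zero_left)
    then have "f v \<in> grade V n" if v: "v \<in> grade V n" for n v
      using aut_conf_eigenvector[OF f v] aut_closed[OF f grade_closed[OF v]]
      by (intro grade_if_L0_eigenvector) simp_all
    then have "gr f = f" by (rule gr_eq_self[OF f])
    then show ?thesis using gr_conf_aut[OF f] by simp
  qed
  then show ?thesis by (auto simp: conf_auts_def)
qed

end

section \<open>Semidirect products from retractions\<close>

text \<open>An idempotent endomorphism \<open>\<rho>\<close> of a group \<open>G\<close> with image \<open>H\<close> and kernel \<open>N\<close> splits \<open>G\<close> by the map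
  \<open>x \<mapsto> (x \<rho>(x)\<^sup>-\<^sup>1, \<rho>(x))\<close>.\<close>

lemma (in group) kernel_of_retraction:
  assumes H: "subgroup H G" and \<rho>: "\<And>x y. x \<in> carrier G \<Longrightarrow> y \<in> carrier G \<Longrightarrow> \<rho> (x \<otimes> y) = \<rho> x \<otimes> \<rho> y"
      "\<And>x. x \<in> carrier G \<Longrightarrow> \<rho> x \<in> H" "\<And>h. h \<in> H \<Longrightarrow> \<rho> h = h"
    and N: "N = {x \<in> carrier G. \<rho> x = \<one>}"
  shows "N \<lhd> G"
    and "G \<cong> semidirect_product (G\<lparr>carrier := N\<rparr>) (G\<lparr>carrier := H\<rparr>) (conjugation G)"
proof -
  have HG: "h \<in> carrier G" if "h \<in> H" for h using subgroup.subset[OF H] that by blast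
  have \<rho>G: "\<rho> x \<in> carrier G" if "x \<in> carrier G" for x using \<rho>(2)[OF that] HG by blast
  have "group_hom G G \<rho>"
    using \<rho>(1) \<rho>G by unfold_locales (auto simp: hom_def)
  moreover have "N = kernel G G \<rho>" by (simp add: N kernel_def)
  ultimately show "N \<lhd> G" using group_hom.normal_kernel by metis
  define \<Phi> where "\<Phi> x = (x \<otimes> inv (\<rho> x), \<rho> x)" for x
  have "\<Phi> \<in> iso G (semidirect_product (G\<lparr>carrier := N\<rparr>) (G\<lparr>carrier := H\<rparr>) (conjugation G))"
  proof (rule isoI)
    have fst: "x \<otimes> inv (\<rho> x) \<in> N" if x: "x \<in> carrier G" for x
    proof -
      have "\<rho> (inv (\<rho> x)) = inv (\<rho> x)" using \<rho>(2)[OF x] \<rho>(3) subgroup.m_inv_closed[OF H] by blast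
      then show ?thesis using x \<rho>G[OF x] \<rho>(1)[of x "inv (\<rho> x)"] by (simp add: N)
    qed
    have mult: "\<Phi> (x \<otimes> y) = \<Phi> x \<otimes>\<^bsub>semidirect_product (G\<lparr>carrier := N\<rparr>) (G\<lparr>carrier := H\<rparr>) (conjugation G)\<^esub> \<Phi> y"
      if x: "x \<in> carrier G" and y: "y \<in> carrier G" for x y
    proof -
      note cl = x y \<rho>G[OF x] \<rho>G[OF y]
      have "x \<otimes> inv (\<rho> x) \<otimes> (\<rho> x \<otimes> (y \<otimes> inv (\<rho> y)) \<otimes> inv (\<rho> x))
        = x \<otimes> (inv (\<rho> x) \<otimes> \<rho> x) \<otimes> y \<otimes> inv (\<rho> y) \<otimes> inv (\<rho> x)"
        using cl by (simp only: m_assoc m_closed inv_closed)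
      also have "\<dots> = x \<otimes> y \<otimes> (inv (\<rho> y) \<otimes> inv (\<rho> x))"
        using cl by (simp add: m_assoc)
      finally show ?thesis
        using cl by (simp add: \<Phi>_def semidirect_product_def conjugation_def \<rho>(1) inv_mult_group)
    qed
    show "\<Phi> \<in> hom G (semidirect_product (G\<lparr>carrier := N\<rparr>) (G\<lparr>carrier := H\<rparr>) (conjugation G))"
    proof (rule homI)
      fix x y assume xy: "x \<in> carrier G" "y \<in> carrier G"
      then show "\<Phi> (x \<otimes> y) = \<Phi> x \<otimes>\<^bsub>semidirect_product (G\<lparr>carrier := N\<rparr>) (G\<lparr>carrier := H\<rparr>) (conjugation G)\<^esub> \<Phi> y"
        by (rule mult)
      show "\<Phi> x \<in> carrier (semidirect_product (G\<lparr>carrier := N\<rparr>) (G\<lparr>carrier := H\<rparr>) (conjugation G))"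
        using fst \<rho>(2) xy(1) by (simp add: \<Phi>_def semidirect_product_def)
    qed
    have "bij_betw \<Phi> (carrier G) (N \<times> H)"
    proof (rule bij_betw_byWitness[where f' = "\<lambda>(n, h). n \<otimes> h"])
      show "\<forall>x\<in>carrier G. (case \<Phi> x of (n, h) \<Rightarrow> n \<otimes> h) = x"
        using \<rho>G by (auto simp: \<Phi>_def m_assoc)
      have "\<Phi> (n \<otimes> h) = (n, h)" if "n \<in> N" "h \<in> H" for n h
      proof -
        have n: "n \<in> carrier G" "\<rho> n = \<one>" and h: "h \<in> carrier G" "\<rho> h = h"
          using that HG \<rho>(3) by (auto simp: N)
        then have "\<rho> (n \<otimes> h) = h" using \<rho>(1) by simp
        then show ?thesis using n h by (simp add: \<Phi>_def m_assoc)
      qed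
      then show "\<forall>p\<in>N \<times> H. \<Phi> (case p of (n, h) \<Rightarrow> n \<otimes> h) = p" by auto
      show "\<Phi> ` carrier G \<subseteq> N \<times> H" using fst \<rho>(2) by (auto simp: \<Phi>_def)
      show "(\<lambda>(n, h). n \<otimes> h) ` (N \<times> H) \<subseteq> carrier G" using HG by (auto simp: N)
    qed
    then show "bij_betw \<Phi> (carrier G)
        (carrier (semidirect_product (G\<lparr>carrier := N\<rparr>) (G\<lparr>carrier := H\<rparr>) (conjugation G)))"
      by (simp add: semidirect_product_def)
  qed
  then show "G \<cong> semidirect_product (G\<lparr>carrier := N\<rparr>) (G\<lparr>carrier := H\<rparr>) (conjugation G)"
    by (rule is_isoI)
qed

context positive_definite_voa
begin

lemma subgroup_conf_auts: "subgroup (conf_auts V) (Aut V)"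
proof -
  interpret A: group "Aut V" by (rule group_Aut)
  show ?thesis
  proof (rule A.subgroupI)
    show "conf_auts V \<subseteq> carrier (Aut V)" by (auto simp: conf_auts_def Aut_simps)
    have "restrict id (carrier V) \<in> conf_auts V" by (simp add: conf_auts_def id_aut conf_closed)
    then show "conf_auts V \<noteq> {}" by blast
    fix f assume f: "f \<in> conf_auts V"
    then have fa: "f \<in> va_auts V" "f (conf V) = conf V" by (auto simp: conf_auts_def)
    have inv: "inv\<^bsub>Aut V\<^esub> f \<in> va_auts V" using A.inv_closed fa by (simp add: Aut_simps)
    have "compose (carrier V) (inv\<^bsub>Aut V\<^esub> f) f = restrict id (carrier V)"
      using A.l_inv[of f] fa inv by (simp add: Aut_simps)
    then have "(inv\<^bsub>Aut V\<^esub> f) (f (conf V)) = conf V"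
      using compose_eq[OF conf_closed, of "inv\<^bsub>Aut V\<^esub> f" f] conf_closed by simp
    then show "inv\<^bsub>Aut V\<^esub> f \<in> conf_auts V" using inv fa by (simp add: conf_auts_def)
    fix g assume "g \<in> conf_auts V"
    then show "f \<otimes>\<^bsub>Aut V\<^esub> g \<in> conf_auts V"
      using fa by (auto simp: conf_auts_def Aut_simps compose_aut compose_eq conf_closed)
  qed
qed

text \<open>The map \<open>gr\<close> is a retraction of \<open>Aut V\<close> onto \<open>Aut\<^sub>\<omega> V\<close> with kernel \<open>Aut\<^sup>- V\<close>.\<close>

theorem Aut_semidirect_product:
  "minus_auts V \<lhd> Aut V"
  "Aut V \<cong> semidirect_product (Aut_minus V) (Aut_conf V) (conjugation (Aut V))"
proof -
  interpret A: group "Aut V" by (rule group_Aut)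
  have "gr (f \<otimes>\<^bsub>Aut V\<^esub> g) = gr f \<otimes>\<^bsub>Aut V\<^esub> gr g" if "f \<in> va_auts V" "g \<in> va_auts V" for f g
    using that by (intro aut_eqI)
      (auto simp: Aut_simps gr_aut compose_aut compose_eq gr_compose)
  then have "minus_auts V \<lhd> Aut V \<and> Aut V \<cong> semidirect_product (Aut V\<lparr>carrier := minus_auts V\<rparr>)
      (Aut V\<lparr>carrier := conf_auts V\<rparr>) (conjugation (Aut V))"
    using A.kernel_of_retraction[OF subgroup_conf_auts, of gr "minus_auts V"]
    by (simp add: Aut_simps gr_conf_aut gr_conf_auts minus_auts_eq_kernel)
  then show "minus_auts V \<lhd> Aut V"
    "Aut V \<cong> semidirect_product (Aut_minus V) (Aut_conf V) (conjugation (Aut V))"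
    by (simp_all add: Aut_minus_def Aut_conf_def)
qed

lemma Aut_iso_Aut_conf:
  assumes "J1 V = {0}"
  shows "Aut V \<cong> Aut_conf V"
  unfolding Aut_conf_def conf_auts_eq_va_auts[OF assms]
  using iso_refl[of "Aut V"] by (simp add: Aut_def)

end

section \<open>The real form of a unitary vertex operator algebra\<close>

text \<open>For positivity and invariance of the form on \<open>V\<^sup>\<sigma>\<close> it suffices to use its real part; that the
  given form is real on \<open>V\<^sup>\<sigma>\<close> is not needed.\<close>

locale unitary_voa = strong_CFT_type V + unitary_structure V \<sigma> form
  for V :: "(complex, 'v::ab_group_add, 'm) conformal_va_scheme" and \<sigma> form
begin

abbreviation W :: "(real, 'v) conformal_va" where "W \<equiv> real_form V \<sigma>"

lemma real_form_simps:
  "carrier W = {v \<in> carrier V. \<sigma> v = v}" "scl W = (\<lambda>r. scl V (complex_of_real r))"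
  "nprod W = nprod V" "vac W = vac V" "grade W n = {v \<in> grade V n. \<sigma> v = v}" "conf W = conf V"
  by (simp_all add: real_form_def)

lemma Vir_real_form: "Vir W = Vir V"
  by (simp add: fun_eq_iff Vir_def real_form_simps)

lemma \<sigma>_closed: "v \<in> carrier V \<Longrightarrow> \<sigma> v \<in> carrier V"
  using \<sigma>_bij by (auto simp: bij_betw_def)

lemma \<sigma>_zero: "\<sigma> 0 = 0"
  using \<sigma>_add[of 0 0] zero_closed by simp

lemma \<sigma>_diff: "u \<in> carrier V \<Longrightarrow> v \<in> carrier V \<Longrightarrow> \<sigma> (u - v) = \<sigma> u - \<sigma> v"
  using \<sigma>_add[of "u - v" v] diff_closed by simp

lemma \<sigma>_sum:
  assumes "\<And>i. i \<in> S \<Longrightarrow> x i \<in> carrier V"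
  shows "\<sigma> (sum x S) = (\<Sum>i\<in>S. \<sigma> (x i))"
  using assms by (induction S rule: infinite_finite_induct) (auto simp: \<sigma>_zero \<sigma>_add sum_closed)

lemma \<sigma>_grade:
  assumes "v \<in> grade V n"
  shows "\<sigma> v \<in> grade V n"
proof (rule grade_if_L0_eigenvector)
  have "\<sigma> (Vir V 0 v) = Vir V 0 (\<sigma> v)"
    using assms by (simp add: Vir_def \<sigma>_nprod conf_closed grade_closed \<sigma>_conf)
  then show "Vir V 0 (\<sigma> v) = scl V (of_int n) (\<sigma> v)"
    using assms by (simp add: L0_grade \<sigma>_antilinear grade_closed)
qed (rule \<sigma>_closed[OF grade_closed[OF assms]])

lemma pr_\<sigma>_fixed:
  assumes v: "v \<in> carrier V" "\<sigma> v = v"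
  shows "\<sigma> (pr V n v) = pr V n v"
proof -
  define S where "S = insert n {n. pr V n v \<noteq> 0}"
  have S: "finite S" using finite_support[OF v(1)] by (simp add: S_def)
  have "(\<Sum>n\<in>S. pr V n v) = v" by (rule sum_pr[OF v(1) S]) (auto simp: S_def)
  then have "v = \<sigma> (\<Sum>n\<in>S. pr V n v)" using v(2) by simp
  also have "\<dots> = (\<Sum>n\<in>S. \<sigma> (pr V n v))" by (intro \<sigma>_sum pr_closed v)
  finally have "pr V n v = pr V n (\<Sum>n\<in>S. \<sigma> (pr V n v))" by simp
  also have "\<dots> = \<sigma> (pr V n v)"
    using S by (subst pr_sum_homogeneous) (auto simp: S_def intro!: \<sigma>_grade pr_grade v)
  finally show ?thesis by simp
qed

lemma vector_space_real_form: "vector_space (scl W)"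
  by unfold_locales (simp_all add: real_form_simps scale_right_distrib scale_left_distrib)

lemma subspace_real_form: "module.subspace (scl W) {v \<in> X. \<sigma> v = v}" if "subspace X" "X \<subseteq> carrier V" for X
proof -
  interpret W: vector_space "scl W" by (rule vector_space_real_form)
  show ?thesis
    using that by (intro W.subspaceI)
      (auto simp: real_form_simps \<sigma>_zero \<sigma>_add \<sigma>_antilinear subset_iff
        intro: subspace_0 subspace_add subspace_scale)
qed

sublocale real_form: vertex_algebra W
proof -
  interpret W: vector_space "scl W" by (rule vector_space_real_form)
  have choose: "complex_of_real (x gchoose i) = complex_of_real x gchoose i" for x i
    by (simp add: gbinomial_prod_rev)
  have [simp]: "complex_of_real (x powi i) = complex_of_real x powi i" for x i
    by (simp add: power_int_def)
  show "vertex_algebra W"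
  proof unfold_locales
    show "W.subspace (carrier W)"
      using subspace_real_form[OF carrier_subspace] by (simp add: real_form_simps)
    fix a b c :: 'v and p q r :: int
    assume "a \<in> carrier W" "b \<in> carrier W" "c \<in> carrier W"
    then show "Sum_any (\<lambda>i::nat. scl W (of_int p gchoose i)
        (nprod W (nprod W a (r + int i) b) (p + q - int i) c)) =
      Sum_any (\<lambda>i::nat. scl W ((-1) ^ i * (of_int r gchoose i))
        (nprod W a (p + r - int i) (nprod W b (q + int i) c)
         - scl W ((-1) powi r) (nprod W b (q + r - int i) (nprod W a (p + int i) c))))"
      using borcherds[of a b c p r q] by (simp add: real_form_simps choose)
  next
    fix a b assume "a \<in> carrier W" "b \<in> carrier W"
    then show "\<exists>N. \<forall>n\<ge>N. nprod W a n b = 0" using truncation by (simp add: real_form_simps)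
  qed (auto simp: real_form_simps vac_closed \<sigma>_vac nprod_closed \<sigma>_nprod nprod_add_left nprod_add_right
      nprod_scl_left nprod_scl_right creation vac_right)
qed

lemma homogeneous_decomp_real_form:
  "homogeneous_decomp W v x \<longleftrightarrow> homogeneous_decomp V v x \<and> (\<forall>n. \<sigma> (x n) = x n)"
  by (auto simp: homogeneous_decomp_def real_form_simps)

sublocale real_form: graded_vertex_algebra W
proof unfold_locales
  fix n
  show "real_form.subspace (grade W n)"
    using subspace_real_form[OF grade_subspace grade_subset] by (simp add: real_form_simps)
  show "grade W n \<subseteq> carrier W" using grade_closed by (auto simp: real_form_simps)
next
  fix v assume "v \<in> carrier W"
  then have v: "v \<in> carrier V" "\<sigma> v = v" by (auto simp: real_form_simps)
  then show "\<exists>!x. homogeneous_decomp W v x"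
    using homogeneous_decomp_pr[OF v(1)] direct_sum[OF v(1)] pr_\<sigma>_fixed[OF v]
    by (auto simp: homogeneous_decomp_real_form)
next
  fix a b n m k assume "a \<in> grade W n" "b \<in> grade W m"
  then show "nprod W a k b \<in> grade W (n + m - k - 1)"
    using grade_nprod \<sigma>_nprod[OF grade_closed[of a n] grade_closed[of b m]]
    by (simp add: real_form_simps)
qed (simp add: real_form_simps vac_grade \<sigma>_vac)

text \<open>The central charge is real, because \<open>L(2)L(-2)\<one> = (c/2) \<one>\<close> is fixed by \<open>\<sigma>\<close>.\<close>

lemma virasoro_real_form:
  "\<exists>c::real. \<forall>n m. \<forall>v\<in>carrier V.
      Vir V n (Vir V m v) - Vir V m (Vir V n v) =
      scl V (of_int (n - m)) (Vir V (n + m) v)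
      + scl V (if n + m = 0 then of_int (n ^ 3 - n) / 12 * complex_of_real c else 0) v"
proof (cases "vac V = 0")
  case True
  have zero: "v = 0" if "v \<in> carrier V" for v
    using vac_nprod[OF that, of "-1"] nprod_zero_left[OF that] True by simp
  have "Vir V n (Vir V m v) - Vir V m (Vir V n v) = scl V (of_int (n - m)) (Vir V (n + m) v)
      + scl V (if n + m = 0 then of_int (n ^ 3 - n) / 12 * complex_of_real 0 else 0) v"
    if "v \<in> carrier V" for n m v
    unfolding zero[OF that] by (simp add: Vir_zero)
  then show ?thesis by blast
next
  case False
  obtain c where c: "\<And>n m v. v \<in> carrier V \<Longrightarrow>
      Vir V n (Vir V m v) - Vir V m (Vir V n v) =
      scl V (of_int (n - m)) (Vir V (n + m) v)
      + scl V (if n + m = 0 then of_int (n ^ 3 - n) / 12 * c else 0) v"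
    using virasoro by blast
  have "Vir V 2 (Vir V (-2) (vac V)) = scl V (c / 2) (vac V)"
    using c[OF vac_closed, of 2 "-2"] L0_grade[OF vac_grade]
    by (simp add: Vir_def creation conf_closed nprod_zero_right)
  moreover have "\<sigma> (Vir V 2 (Vir V (-2) (vac V))) = Vir V 2 (Vir V (-2) (vac V))"
    by (simp add: Vir_def \<sigma>_nprod closed conf_closed \<sigma>_conf \<sigma>_vac)
  ultimately have "scl V (cnj (c / 2)) (vac V) = scl V (c / 2) (vac V)"
    by (simp add: \<sigma>_antilinear vac_closed \<sigma>_vac)
  then have "cnj c = c" using False by simp
  then have "c = complex_of_real (Re c)" by (simp add: complex_eq_iff)
  then show ?thesis using c by metis
qed

sublocale real_form: conformal_vertex_algebra W
proof unfold_locales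
  show "\<exists>c. \<forall>n m. \<forall>v\<in>carrier W.
      Vir W n (Vir W m v) - Vir W m (Vir W n v) =
      scl W (of_int (n - m)) (Vir W (n + m) v)
      + scl W (if n + m = 0 then of_int (n ^ 3 - n) / 12 * c else 0) v"
  proof -
    obtain c :: real where c: "\<And>n m v. v \<in> carrier V \<Longrightarrow>
        Vir V n (Vir V m v) - Vir V m (Vir V n v) =
        scl V (of_int (n - m)) (Vir V (n + m) v)
        + scl V (if n + m = 0 then of_int (n ^ 3 - n) / 12 * complex_of_real c else 0) v"
      using virasoro_real_form by blast
    show ?thesis
      by (rule exI[of _ c]) (auto simp: Vir_real_form real_form_simps c)
  qed
qed (auto simp: real_form_simps Vir_real_form conf_grade \<sigma>_conf L0_grade translation)

lemma opposite_mode_quasi_primary: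
  assumes a: "a \<in> grade V n" and L1a: "Vir V 1 a = 0" and u: "u \<in> carrier V"
  shows "opposite_mode V a p u = scl V ((-1) powi n) (nprod V a (2 * n - 2 - p) u)"
proof -
  define t where "t m k = scl V ((-1) powi m / fact k)
      (nprod V ((Vir V 1 ^^ k) (pr V m a)) (2 * m - int k - p - 2) u)" for m :: int and k :: nat
  have pow0: "(Vir V 1 ^^ k) 0 = 0" for k by (induction k) (auto simp: Vir_zero)
  have "(Vir V 1 ^^ k) a = 0" if k: "k > 0" for k
  proof -
    obtain k' where "k = Suc k'" using gr0_implies_Suc[OF k] by blast
    then show ?thesis by (simp only: funpow_Suc_right comp_apply L1a pow0)
  qed
  then have t0: "t m k = 0" if "(m, k) \<noteq> (n, 0)" for m k
    using that by (auto simp: t_def pr_homogeneous[OF a] pow0 nprod_zero_left u)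
  have inner: "Sum_any (t m) = (if m = n then t n 0 else 0)" for m
  proof -
    have "{k. t m k \<noteq> 0} \<subseteq> {0}" using t0 by blast
    then have "Sum_any (t m) = t m 0" by (subst Sum_any.expand_superset[of "{0}"]) simp_all
    then show ?thesis using t0[of m 0] by auto
  qed
  have "opposite_mode V a p u = Sum_any (\<lambda>m. Sum_any (t m))"
    by (simp add: opposite_mode_def t_def)
  also have "\<dots> = t n 0"
    unfolding inner by (subst Sum_any.expand_superset[of "{n}"]) auto
  also have "\<dots> = scl V ((-1) powi n) (nprod V a (2 * n - 2 - p) u)"
    by (simp add: t_def pr_homogeneous[OF a] algebra_simps)
  finally show ?thesis .
qed

sublocale real_form: positive_definite_voa W "\<lambda>u v. Re (form u v)"
proof unfold_locales
  fix n :: int assume "n < 0"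
  then show "grade W n = {0}" using grade_neg by (auto simp: real_form_simps \<sigma>_zero)
next
  fix v assume "v \<in> grade W 0"
  then have v: "v \<in> grade V 0" "\<sigma> v = v" by (auto simp: real_form_simps)
  then obtain k where k: "v = scl V k (vac V)" using grade_zero by blast
  show "\<exists>k. v = scl W k (vac W)"
  proof (cases "vac V = 0")
    case True
    then show ?thesis using k by (simp add: real_form_simps)
  next
    case False
    have "scl V (cnj k) (vac V) = scl V k (vac V)"
      using v(2) k by (simp add: \<sigma>_antilinear vac_closed \<sigma>_vac)
    then have "k = complex_of_real (Re k)" using False by (simp add: complex_eq_iff)
    then show ?thesis using k by (auto simp: real_form_simps)
  qed
next
  fix v assume "v \<in> grade W 1"
  then show "Vir W 1 v = 0" using L1_grade_one by (simp add: real_form_simps Vir_real_form)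
next
  fix a u v n p
  assume "a \<in> grade W n" "Vir W 1 a = 0" "u \<in> carrier W" "v \<in> carrier W"
  then have *: "a \<in> grade V n" "\<sigma> a = a" "Vir V 1 a = 0" "u \<in> carrier V" "v \<in> carrier V"
    by (auto simp: real_form_simps Vir_real_form)
  note cl = *(4,5) grade_closed[OF *(1)] closed
  have "form u (nprod V a (2 * n - 2 - p) v) = (-1) powi n * form (nprod V a p u) v"
    using form_invariant[of a u v "2 * n - 2 - p"] opposite_mode_quasi_primary[OF *(1,3,4), of "2 * n - 2 - p"]
    by (simp add: cl *(2) form_scl)
  moreover have "(-1) powi n * (-1) powi n = (1::complex)" by (simp flip: power_int_mult_distrib)
  ultimately have "form (nprod V a p u) v = (-1) powi n * form u (nprod V a (2 * n - 2 - p) v)"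
    by (simp flip: mult.assoc)
  moreover have "Re ((-1) powi n * z) = (-1) powi n * Re z" for z
  proof -
    have "((-1) powi n :: complex) = complex_of_real ((-1) powi n)" by (simp add: power_int_def)
    then show ?thesis by (simp only: scaleR_conv_of_real[symmetric] scaleR_complex.simps)
  qed
  ultimately show "Re (form (nprod W a p u) v) = (-1) powi n * Re (form u (nprod W a (2 * n - 2 - p) v))"
    by (simp add: real_form_simps)
qed (auto simp: real_form_simps form_add form_scl form_pos,
    metis form_hermitian cnj.simps(1))

lemma J1_real_form:
  assumes "J1 V = {0}"
  shows "J1 W = {0}"
proof -
  have "a = 0" if "a \<in> J1 W" for a
  proof -
    have a: "a \<in> grade V 1" and zero: "\<And>v. v \<in> carrier V \<Longrightarrow> \<sigma> v = v \<Longrightarrow> nprod V a 0 v = 0"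
      using that by (auto simp: J1_def real_form_simps)
    have "nprod V a 0 v = 0" if v: "v \<in> carrier V" for v
    proof -
      note cl = closed v \<sigma>_closed grade_closed[OF a]
      have 1: "nprod V a 0 (v + \<sigma> v) = 0"
        by (rule zero) (simp_all add: cl \<sigma>_add \<sigma>_involution add.commute)
      have 2: "nprod V a 0 (scl V \<i> (v - \<sigma> v)) = 0"
        by (rule zero) (simp_all add: cl \<sigma>_diff \<sigma>_antilinear \<sigma>_involution scale_right_diff_distrib)
      have "scl V 2 (nprod V a 0 v) = nprod V a 0 (v + \<sigma> v) + nprod V a 0 (v - \<sigma> v)"
        by (simp add: cl nprod_add_right nprod_diff_right scale_left_distrib[of 1 1, simplified])
      also have "nprod V a 0 (v - \<sigma> v) = 0" using 2 by (simp add: nprod_scl_right cl)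
      finally show ?thesis using 1 by simp
    qed
    then have "a \<in> J1 V" using a by (simp add: J1_def)
    then show ?thesis using assms by simp
  qed
  moreover have "0 \<in> J1 W"
    using zero_grade nprod_zero_left by (simp add: J1_def real_form_simps \<sigma>_zero)
  ultimately show ?thesis by blast
qed

end

theorem corollary7p1:
  fixes V :: "(complex, 'v::ab_group_add) conformal_va"
    and \<sigma> :: "'v \<Rightarrow> 'v"
    and form :: "'v \<Rightarrow> 'v \<Rightarrow> complex"
  assumes "strong_CFT_type V"
    and "simple_va V"
    and "unitary_structure V \<sigma> form"
  shows "(minus_auts (real_form V \<sigma>) \<lhd> Aut (real_form V \<sigma>) \<and>
      subgroup (conf_auts (real_form V \<sigma>)) (Aut (real_form V \<sigma>)) \<and>
      Aut (real_form V \<sigma>) \<cong>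
        semidirect_product (Aut_minus (real_form V \<sigma>)) (Aut_conf (real_form V \<sigma>))
          (conjugation (Aut (real_form V \<sigma>)))) \<and>
    (J1 V = {0} \<longrightarrow> Aut (real_form V \<sigma>) \<cong> Aut_conf (real_form V \<sigma>))"
proof -
  interpret strong_CFT_type V by fact
  interpret unitary_structure V \<sigma> form by fact
  interpret unitary_voa V \<sigma> form ..
  show ?thesis
    using real_form.Aut_semidirect_product real_form.subgroup_conf_auts
      real_form.Aut_iso_Aut_conf J1_real_form by blast
qed

end
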